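(* Let $Y$ be a Poisson point process of intensity $\lambda$ on the space $\mathbb{G}$ of lines in $\mathbb{H}^2$ with respect to the isometry-invariant measure $\Phi$, and let $\mathcal{Z}\subset\mathbb{H}^2$ be the complement of the union of all lines in $Y$. If $\lambda\ge 1$, then almost surely $\mathcal{Z}$ contains no lines. If $\lambda<1$, then almost surely $\mathcal{Z}$ contains lines.
   Context: $\mathbb{G}$ is the set of unoriented lines (bi-infinite geodesics) in the hyperbolic plane $\mathbb{H}^2$. In the upper half-plane model, with boundary at infinity $\hat{\mathbb{R}}=\mathbb{R}\cup\{\infty\}$, associating to each line its pair of endpoints at infinity identifies $\mathbb{G}$ with $$\mathbb{M}:=\bigl\{\{x,y\}: x,y\in\hat{\mathbb{R}},\ x\neq y\bigr\}.$$ $\mathbb{M}$ carries the locally Euclidean metric coming from the $2$-to-$1$ projection from $\hat{\mathbb{R}}\times\hat{\mathbb{R}}\setminus\text{diagonal}$. The measure $\Phi$ on $\mathbb{M}$ (equivalently on $\mathbb{G}$) is the one whose density at $\{x,y\}$ with $x,y\ne\infty$ with respect to Euclidean area measure is $$d\Phi=\frac{dx\,dy}{(x-y)^2}$$ (each unordered pair being counted once), and $\Phi\bigl(\bigl\{\{x,\infty\}:x\in\mathbb{R}\bigr\}\bigr)=0$. The Poisson process $Y$ has intensity measure $\lambda\Phi$, where $\lambda>0$. *)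

theory Defs
  imports "HOL-Probability.Probability"
begin

section \<open>Lines in the upper half-plane\<close>

definition upper_half_plane :: "complex set" where
  "upper_half_plane = {z. Im z > 0}"

definition hyp_dist :: "complex \<Rightarrow> complex \<Rightarrow> real" where
  "hyp_dist z w = arcosh (1 + (dist z w)\<^sup>2 / (2 * Im z * Im w))"

text \<open>An unoriented line is the range of an isometric embedding of the real axis.\<close>

definition hyp_lines :: "complex set set" where
  "hyp_lines = {L. \<exists>\<gamma> :: real \<Rightarrow> complex. L = range \<gamma> \<and> range \<gamma> \<subseteq> upper_half_plane \<and>
                     (\<forall>s t. hyp_dist (\<gamma> s) (\<gamma> t) = \<bar>s - t\<bar>)}"

text \<open>
  The boundary at infinity is the one-point compactification of the real line, carried by
  \<^typ>\<open>real option\<close>, with \<^term>\<open>None\<close> as the point at infinity.  It is attached to the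
  half-plane as in the Riemann sphere, where \<^term>\<open>None\<close> adheres to exactly the unbounded sets.
\<close>

abbreviation boundary :: "real option topology" where
  "boundary \<equiv> Alexandroff_compactification euclideanreal"

definition endpoints :: "complex set \<Rightarrow> real option set" where
  "endpoints L = {Some x |x. complex_of_real x \<in> closure L} \<union> {p. p = None \<and> \<not> bounded L}"

definition endpoint_pairs :: "real option set set" where
  "endpoint_pairs = {{p, q} |p q. p \<noteq> q}"

text \<open>
  The map \<^term>\<open>endpoints\<close> is a bijection from the lines onto the pairs (lemma
  \<open>bij_betw_endpoints\<close> below), so this is the line joining two distinct boundary points.
\<close>

definition line_between :: "real option \<Rightarrow> real option \<Rightarrow> complex set" where
  "line_between p q = the_inv_into hyp_lines endpoints {p, q}"


section \<open>The invariant measure\<close>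

text \<open>
  The Borel sets of the space of lines: a set of lines is open iff the set of ordered pairs of
  distinct boundary points that it corresponds to is open (quotient topology).
\<close>

definition lines_borel :: "complex set measure" where
  "lines_borel = sigma hyp_lines
     {A. A \<subseteq> hyp_lines \<and>
         openin (subtopology (prod_topology boundary boundary) {(p, q). p \<noteq> q})
                {(p, q). p \<noteq> q \<and> {p, q} \<in> endpoints ` A}}"

text \<open>
  Restricting to \<open>x < y\<close> counts each unordered pair once; lines ending at infinity get measure
  zero, as they are not in the range of the map being pushed forward.
\<close>

definition \<Phi> :: "complex set measure" where
  "\<Phi> = distr (density (restrict_space lborel {(x :: real, y :: real). x < y})
                     (\<lambda>(x, y). ennreal (1 / (x - y)\<^sup>2)))
             lines_borel (\<lambda>(x, y). line_between (Some x) (Some y))"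


section \<open>Poisson point processes\<close>

text \<open>
  The process is a random set of points of \<open>M\<close>, which is adequate for intensity measures without
  atoms (such as \<^term>\<open>\<Phi>\<close>), for which a Poisson process has almost surely no multiple points.
  Sets of infinite intensity need no separate clause: for sigma-finite \<open>M\<close> their counts are
  almost surely infinite by the other clauses.
\<close>

definition point_count :: "'a set \<Rightarrow> 'a set \<Rightarrow> ennreal" where
  "point_count S A = emeasure (count_space UNIV) (S \<inter> A)"

definition poisson_process :: "'w measure \<Rightarrow> 'a measure \<Rightarrow> ('w \<Rightarrow> 'a set) \<Rightarrow> bool" where
  "poisson_process P M Y \<longleftrightarrow>
     prob_space P \<and>
     (\<forall>\<omega> \<in> space P. Y \<omega> \<subseteq> space M) \<and>
     (\<forall>A \<in> sets M. (\<lambda>\<omega>. point_count (Y \<omega>) A) \<in> borel_measurable P) \<and>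
     (\<forall>A \<in> sets M. emeasure M A < \<infinity> \<longrightarrow>
        (\<forall>k. measure P {\<omega> \<in> space P. point_count (Y \<omega>) A = of_nat k} =
             measure M A ^ k / fact k * exp (- measure M A))) \<and>
     (\<forall>n (A :: nat \<Rightarrow> 'a set). A ` {..<n} \<subseteq> sets M \<and> disjoint_family_on A {..<n} \<longrightarrow>
        prob_space.indep_vars P (\<lambda>_. borel) (\<lambda>i \<omega>. point_count (Y \<omega>) (A i)) {..<n})"


section \<open>The vacant set\<close>

definition vacant_set :: "complex set set \<Rightarrow> complex set" where
  "vacant_set S = upper_half_plane - \<Union> S"


section \<open>Adequacy of the definitions\<close>

text \<open>
  The lines are the semicircles centred on the real axis and the vertical half-lines, so that
  \<^term>\<open>endpoints\<close> is a bijection onto the pairs of distinct boundary points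
  (\<open>bij_betw_endpoints\<close>).  The map pushed forward in the definition of \<^term>\<open>\<Phi>\<close> is
  measurable, whence \<^term>\<open>\<Phi>\<close> has the intended density (\<open>emeasure_Phi\<close>) and gives measure
  zero to the lines ending at infinity (\<open>lines_to_infinity_null\<close>).
\<close>

definition semicircle :: "real \<Rightarrow> real \<Rightarrow> complex set" where
  "semicircle x y = {z. Im z > 0 \<and> (Re z - x) * (Re z - y) + (Im z)\<^sup>2 = 0}"

definition vertical :: "real \<Rightarrow> complex set" where
  "vertical x = {z. Im z > 0 \<and> Re z = x}"

lemma cosh_hyp_dist:
  assumes "Im z > 0" "Im w > 0"
  shows "cosh (hyp_dist z w) = 1 + (dist z w)\<^sup>2 / (2 * Im z * Im w)"
  unfolding hyp_dist_def using assms by (intro cosh_arcosh_real) simp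

lemma hyp_dist_eqI:
  assumes "Im z > 0" "Im w > 0" 
    and "((Re z)\<^sup>2 + (Im z)\<^sup>2 + (Re w)\<^sup>2 + (Im w)\<^sup>2 - 2 * Re z * Re w) / (2 * Im z * Im w) = cosh d"
  shows "hyp_dist z w = \<bar>d\<bar>"
proof -
  have "1 + (dist z w)\<^sup>2 / (2 * Im z * Im w) = cosh \<bar>d\<bar>"
    using assms(1,2) unfolding cosh_real_abs assms(3)[symmetric]
    by (simp add: dist_norm cmod_power2 field_simps) (simp add: algebra_simps power2_eq_square)
  then show ?thesis unfolding hyp_dist_def by (simp only: arcosh_cosh_real abs_ge_zero)
qed

lemma vertical_in_hyp_lines: "vertical x \<in> hyp_lines"
proof -
  let ?g = "\<lambda>t. Complex x (exp t)"
  have "vertical x = range ?g"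
  proof (intro equalityI subsetI)
    fix z assume "z \<in> vertical x"
    then have "z = ?g (ln (Im z))" by (auto simp: vertical_def complex_eq_iff)
    then show "z \<in> range ?g" by blast
  qed (auto simp: vertical_def)
  moreover have "hyp_dist (?g s) (?g t) = \<bar>s - t\<bar>" for s t
    by (rule hyp_dist_eqI) (auto simp: cosh_field_def exp_diff exp_minus field_simps power2_eq_square)
  ultimately show ?thesis unfolding hyp_lines_def upper_half_plane_def
    by (intro CollectI exI[of _ ?g]) auto
qed

lemma semicircle_in_hyp_lines:
  assumes "x < y" shows "semicircle x y \<in> hyp_lines"
proof -
  let ?D = "\<lambda>t. exp t + exp (-t)"
  let ?g = "\<lambda>t. Complex ((exp t * y + exp (-t) * x) / ?D t) ((y - x) / ?D t)"
  have D: "?D t > 0" for t :: real by (simp add: add_pos_pos)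
  have "semicircle x y = range ?g"
  proof (intro equalityI subsetI)
    fix z assume z: "z \<in> semicircle x y"
    define a b where "a = Re z - x" and "b = y - Re z"
    have ab: "a * b = (Im z)\<^sup>2" "Im z > 0" using z by (auto simp: semicircle_def a_def b_def algebra_simps)
    have "a + b > 0" using assms by (simp add: a_def b_def)
    moreover have "a * b > 0" using ab by simp
    ultimately have pos: "a > 0" "b > 0" by (auto simp: zero_less_mult_iff)
    define t where "t = ln (a / b) / 2"
    have e2: "exp t * exp t = a / b" using pos
      by (simp add: t_def flip: exp_add)
    have "exp t = sqrt (a / b)" using e2 by (metis exp_ge_zero real_sqrt_abs2 abs_of_nonneg)
    then have et: "exp t = Im z / b" 
      using pos ab by (metis abs_of_pos less_imp_le mult.commute nonzero_mult_divide_mult_cancel_right2 order_less_irrefl power2_eq_square real_sqrt_abs real_sqrt_divide real_sqrt_mult_self abs_of_nonneg real_sqrt_abs2)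
    have et': "exp (-t) = b / Im z" by (simp add: exp_minus et)
    have bn: "b \<noteq> 0" "y \<noteq> x" "Im z \<noteq> 0" using pos assms ab by auto
    have iz: "Im z / b = a / Im z" using ab bn by (simp add: field_simps power2_eq_square)
    have Dt: "?D t = (y - x) / Im z"
      unfolding et et' iz by (simp add: a_def b_def flip: add_divide_distrib)
    have "exp t * y + exp (-t) * x = (a * y + b * x) / Im z"
      unfolding et et' iz by (simp add: add_divide_distrib)
    also have "a * y + b * x = Re z * (y - x)" by (simp add: a_def b_def algebra_simps)
    finally have "z = ?g t" unfolding complex_eq_iff complex.sel Dt
      using bn by simp
    then show "z \<in> range ?g" by blast
  next
    fix z assume "z \<in> range ?g"
    then obtain t where z: "z = ?g t" by blast
    have 1: "Re z - x = exp t * (y - x) / ?D t" "Re z - y = - exp (-t) * (y - x) / ?D t"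
      using D[of t] by (simp_all add: z field_simps)
    have "exp t * exp (-t) = (1::real)" by (simp flip: exp_add)
    then have "(Re z - x) * (Re z - y) = - ((y - x) / ?D t)\<^sup>2"
      unfolding 1 by (simp add: power2_eq_square)
    then show "z \<in> semicircle x y" unfolding semicircle_def
      using D[of t] assms by (simp add: z)
  qed
  moreover have "hyp_dist (?g s) (?g t) = \<bar>s - t\<bar>" for s t
  proof -
    define S T where "S = exp s" and "T = exp t"
    have p: "S > 0" "T > 0" by (auto simp: S_def T_def)
    have m: "exp (-s) = 1 / S" "exp (-t) = 1 / T" by (simp_all add: S_def T_def exp_minus field_simps)
    have c: "cosh (s - t) = (S / T + T / S) / 2" by (simp add: S_def T_def cosh_field_def exp_diff)
    have yx: "y - x > 0" using assms by simp
    define d where "d = y - x"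
    have y: "y = x + d" by (simp add: d_def)
    have d: "d > 0" using assms by (simp add: d_def)
    have e: "S + 1 / S > 0" "T + 1 / T > 0" using p by (auto intro: add_pos_pos)
    have R: "(E * y + x / E) / (E + 1 / E) = x + d * E\<^sup>2 / (E\<^sup>2 + 1)" if "E > 0" for E
    proof -
      have "E\<^sup>2 + 1 > 0" by (simp add: add_nonneg_pos)
      then show ?thesis using that by (simp add: y divide_simps power2_eq_square) (simp add: algebra_simps)
    qed
    have I: "d / (E + 1 / E) = d * E / (E\<^sup>2 + 1)" if "E > 0" for E
      using that by (simp add: divide_simps power2_eq_square)
    have q: "S\<^sup>2 + 1 > 0" "T\<^sup>2 + 1 > 0" by (simp_all add: add_nonneg_pos)
    define p' q' where "p' = S\<^sup>2 + 1" and "q' = T\<^sup>2 + 1"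
    have pq: "p' > 0" "q' > 0" using q by (auto simp: p'_def q'_def)
    have "((x + d * S\<^sup>2 / p')\<^sup>2 + (d * S / p')\<^sup>2 + (x + d * T\<^sup>2 / q')\<^sup>2 + (d * T / q')\<^sup>2 
         - 2 * (x + d * S\<^sup>2 / p') * (x + d * T\<^sup>2 / q')) 
         = (d / (p' * q'))\<^sup>2 * ((S\<^sup>2 * q' - T\<^sup>2 * p')\<^sup>2 + (S * q')\<^sup>2 + (T * p')\<^sup>2)"
      using pq by (simp add: divide_simps power2_eq_square) (simp add: algebra_simps)
    also have "(S\<^sup>2 * q' - T\<^sup>2 * p')\<^sup>2 + (S * q')\<^sup>2 + (T * p')\<^sup>2 = p' * q' * (S\<^sup>2 + T\<^sup>2)"
      by (simp add: p'_def q'_def power2_eq_square algebra_simps)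
    finally have *: "((x + d * S\<^sup>2 / p')\<^sup>2 + (d * S / p')\<^sup>2 + (x + d * T\<^sup>2 / q')\<^sup>2 + (d * T / q')\<^sup>2 
         - 2 * (x + d * S\<^sup>2 / p') * (x + d * T\<^sup>2 / q')) / (2 * (d * S / p') * (d * T / q'))
         = (S / T + T / S) / 2"
      using pq p d by (simp add: divide_simps power2_eq_square)
    show ?thesis
    proof (rule hyp_dist_eqI)
      show "Im (?g s) > 0" "Im (?g t) > 0" using D assms by auto
    qed (use * p in \<open>simp only: complex.sel m S_def[symmetric] T_def[symmetric] c mult_1 times_divide_eq_left
           R I d_def[symmetric] p'_def q'_def\<close>)
  qed
  moreover have "range ?g \<subseteq> upper_half_plane" using D assms by (auto simp: upper_half_plane_def)
  ultimately show ?thesis unfolding hyp_lines_def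
    by (intro CollectI exI[of _ ?g]) blast
qed


lemma exp_mult_exp_minus: "exp t * exp (-t) = (1::real)" "exp (-t) * exp t = (1::real)"
  by (simp_all flip: exp_add)

lemma null_orthogonal:
  fixes a b c u v w :: real
  assumes "a * c - b\<^sup>2 = 1" "a > 0" "u * w = v\<^sup>2" "a * w + c * u = 2 * b * v"
  shows "u = 0" "v = 0" "w = 0"
proof -
  have "(a * v - b * u)\<^sup>2 + u\<^sup>2 = (a * v - b * u)\<^sup>2 + (a * c - b\<^sup>2) * u\<^sup>2" using assms(1) by simp
  also have "\<dots> = a * (a * v\<^sup>2 - 2 * b * v * u + c * u\<^sup>2)" by (simp add: power2_eq_square algebra_simps)
  also have "\<dots> = a * (a * (u * w) - (a * w + c * u) * u + c * u\<^sup>2)" by (simp only: assms(3,4))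
  also have "\<dots> = 0" by (simp add: power2_eq_square algebra_simps)
  finally have "(a * v - b * u)\<^sup>2 + u\<^sup>2 = 0" .
  then show "u = 0" by (simp add: sum_power2_eq_zero_iff)
  then show "v = 0" using assms(3) by simp
  then show "w = 0" using \<open>u = 0\<close> assms(2,4) by simp
qed

lemma geodesic_param:
  fixes \<gamma> :: "real \<Rightarrow> complex"
  assumes up: "\<And>t. Im (\<gamma> t) > 0" and iso: "\<And>s t. hyp_dist (\<gamma> s) (\<gamma> t) = \<bar>s - t\<bar>"
  obtains pa pb pc qa qb qc :: real where
    "\<And>t. 1 / Im (\<gamma> t) = exp t * pa + exp (-t) * qa"
    "\<And>t. Re (\<gamma> t) / Im (\<gamma> t) = exp t * pb + exp (-t) * qb"
    "pa * pc = pb\<^sup>2" "qa * qc = qb\<^sup>2" "pa * qc + pc * qa - 2 * pb * qb = 1"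
    "pa \<ge> 0" "qa \<ge> 0"
proof -
  define A B C where "A = (\<lambda>t. 1 / Im (\<gamma> t))" and "B = (\<lambda>t. Re (\<gamma> t) / Im (\<gamma> t))"
    and "C = (\<lambda>t. ((Re (\<gamma> t))\<^sup>2 + (Im (\<gamma> t))\<^sup>2) / Im (\<gamma> t))"
  have AB: "A t = 1 / Im (\<gamma> t)" "B t = Re (\<gamma> t) / Im (\<gamma> t)" for t by (simp_all add: A_def B_def)
  have form: "(A s * C t + C s * A t) / 2 - B s * B t = cosh (s - t)" for s t
  proof -
    have "(A s * C t + C s * A t) / 2 - B s * B t = 1 + (dist (\<gamma> s) (\<gamma> t))\<^sup>2 / (2 * Im (\<gamma> s) * Im (\<gamma> t))"
      using up[of s] up[of t] by (simp add: A_def B_def C_def dist_norm cmod_power2 field_simps)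
         (simp add: algebra_simps power2_eq_square)
    then show ?thesis using cosh_hyp_dist[OF up up, of s t] by (simp add: iso cosh_real_abs)
  qed
  have unit: "A t * C t - (B t)\<^sup>2 = 1" for t
    using form[of t t] by (simp add: power2_eq_square)
  have Apos: "A t > 0" for t using up by (simp add: A_def)
  have lin: "sinh 1 * A t - sinh t * A 1 - sinh (1 - t) * A 0 = 0 \<and>
             sinh 1 * B t - sinh t * B 1 - sinh (1 - t) * B 0 = 0 \<and>
             sinh 1 * C t - sinh t * C 1 - sinh (1 - t) * C 0 = 0" for t
  proof -
    define k l m :: real where "k = sinh 1" and "l = sinh t" and "m = sinh (1 - t)"
    let ?u = "k * A t - l * A 1 - m * A 0"
    let ?v = "k * B t - l * B 1 - m * B 0"
    let ?w = "k * C t - l * C 1 - m * C 0"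
    have orth: "A s * ?w + C s * ?u - 2 * B s * ?v = 2 * (k * cosh (s - t) - l * cosh (s - 1) - m * cosh s)" for s
    proof -
      have c: "cosh s = (A s * C 0 + C s * A 0) / 2 - B s * B 0" using form[of s 0] by simp
      show ?thesis unfolding form[of s t, symmetric] form[of s 1, symmetric] c by (simp add: field_simps)
    qed
    have 0: "k * cosh (0 - t) - l * cosh (0 - 1) - m * cosh 0 = 0"
      by (simp add: k_def l_def m_def sinh_diff)
    have 1: "k * cosh (1 - t) - l * cosh (1 - 1) - m * cosh 1 = 0"
    proof -
      have "sinh (1 - (1 - t)) = sinh 1 * cosh (1 - t) - cosh 1 * sinh (1 - t)" by (rule sinh_diff)
      then show ?thesis by (simp add: k_def l_def m_def)
    qed
    have t: "k * cosh (t - t) - l * cosh (t - 1) - m * cosh t = 0"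
    proof -
      have "sinh (t + (1 - t)) = sinh t * cosh (1 - t) + cosh t * sinh (1 - t)" by (rule sinh_add)
      moreover have "cosh (t - 1) = cosh (1 - t)" by (metis cosh_minus minus_diff_eq)
      ultimately show ?thesis by (simp add: k_def l_def m_def)
    qed
    have "2 * (?u * ?w - ?v\<^sup>2) = k * (A t * ?w + C t * ?u - 2 * B t * ?v)
         - l * (A 1 * ?w + C 1 * ?u - 2 * B 1 * ?v) - m * (A 0 * ?w + C 0 * ?u - 2 * B 0 * ?v)"
      by (simp add: power2_eq_square algebra_simps)
    also have "\<dots> = 0" unfolding orth using 0 1 t by simp
    finally have n: "?u * ?w = ?v\<^sup>2" by simp
    have o: "A 0 * ?w + C 0 * ?u = 2 * B 0 * ?v" using orth[of 0] 0 by simp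
    from null_orthogonal[OF unit[of 0] Apos n o] show ?thesis by (auto simp: k_def l_def m_def)
  qed
  have s1: "sinh 1 > (0::real)" by simp
  have param: "X t = exp t * ((X 0 + (X 1 - cosh 1 * X 0) / sinh 1) / 2)
                 + exp (-t) * ((X 0 - (X 1 - cosh 1 * X 0) / sinh 1) / 2)"
    if "sinh 1 * X t - sinh t * X 1 - sinh (1 - t) * X 0 = 0" for X :: "real \<Rightarrow> real" and t
  proof -
    have "X t = (sinh t * X 1 + (sinh 1 * cosh t - cosh 1 * sinh t) * X 0) / sinh 1"
      using that s1 by (simp add: sinh_diff field_simps)
    also have "\<dots> = cosh t * X 0 + sinh t * ((X 1 - cosh 1 * X 0) / sinh 1)"
      using s1 by (simp add: divide_simps) (simp add: algebra_simps)
    finally show ?thesis by (simp add: cosh_field_def sinh_field_def algebra_simps add_divide_distrib diff_divide_distrib)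
  qed
  define p where "p = (\<lambda>X :: real \<Rightarrow> real. (X 0 + (X 1 - cosh 1 * X 0) / sinh 1) / 2)"
  define q where "q = (\<lambda>X :: real \<Rightarrow> real. (X 0 - (X 1 - cosh 1 * X 0) / sinh 1) / 2)"
  have At: "A t = exp t * p A + exp (-t) * q A" for t unfolding p_def q_def by (rule param) (use lin in blast)
  have Bt: "B t = exp t * p B + exp (-t) * q B" for t unfolding p_def q_def by (rule param) (use lin in blast)
  have Ct: "C t = exp t * p C + exp (-t) * q C" for t unfolding p_def q_def by (rule param) (use lin in blast)
  have quad: "u\<^sup>2 * (p A * p C - (p B)\<^sup>2) + (p A * q C + p C * q A - 2 * p B * q B) + v\<^sup>2 * (q A * q C - (q B)\<^sup>2) = 1"
    if "u > 0" "u * v = 1" for u v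
  proof -
    have "exp (- ln u) = 1 / u" using that(1) by (simp add: exp_minus inverse_eq_divide)
    moreover have "v = 1 / u" using that by (simp add: field_simps)
    ultimately have e: "exp (ln u) = u" "exp (- ln u) = v" using that by simp_all
    have "1 = (u * p A + v * q A) * (u * p C + v * q C) - (u * p B + v * q B)\<^sup>2"
      using unit[of "ln u"] At[of "ln u"] Bt[of "ln u"] Ct[of "ln u"] unfolding e by metis
    also have "\<dots> = u\<^sup>2 * (p A * p C - (p B)\<^sup>2) + (u * v) * (p A * q C + p C * q A - 2 * p B * q B) + v\<^sup>2 * (q A * q C - (q B)\<^sup>2)"
      by (simp add: power2_eq_square algebra_simps)
    finally show ?thesis unfolding that(2) by simp
  qed
  have z: "p A * p C - (p B)\<^sup>2 = 0" "q A * q C - (q B)\<^sup>2 = 0" "p A * q C + p C * q A - 2 * p B * q B = 1"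
  proof -
    have *: "a = 0 \<and> c = 0 \<and> b = 1" if "1 * a + b + 1 * c = 1" "4 * a + b + (1/4) * c = 1" "(1/4) * a + b + 4 * c = 1"
      for a b c :: real using that by linarith
    have sq: "1\<^sup>2 = (1 :: real)" "2\<^sup>2 = (4 :: real)" "(1/2)\<^sup>2 = (1/4 :: real)" by (simp_all add: power2_eq_square)
    have "p A * p C - (p B)\<^sup>2 = 0 \<and> q A * q C - (q B)\<^sup>2 = 0 \<and> p A * q C + p C * q A - 2 * p B * q B = 1"
      by (intro *[OF quad[of 1 1, unfolded sq] quad[of 2 "1/2", unfolded sq] quad[of "1/2" 2, unfolded sq]]) simp_all
    then show "p A * p C - (p B)\<^sup>2 = 0" "q A * q C - (q B)\<^sup>2 = 0" "p A * q C + p C * q A - 2 * p B * q B = 1"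
      by blast+
  qed
  have sgn: "x \<ge> 0" if "\<And>u. u > 0 \<Longrightarrow> u * x + y / u > 0" for x y :: real
  proof (rule ccontr)
    assume "\<not> x \<ge> 0"
    define r where "r = (\<bar>y\<bar> + 1) / (-x)"
    have "r > 0" using \<open>\<not> x \<ge> 0\<close> unfolding r_def by (intro divide_pos_pos) auto
    then have pos: "sqrt r > 0" by simp
    have "sqrt r * (sqrt r * x + y / sqrt r) > 0" by (rule mult_pos_pos[OF pos that[OF pos]])
    also have "sqrt r * (sqrt r * x + y / sqrt r) = (sqrt r * sqrt r) * x + y"
      using pos by (simp add: distrib_left mult.assoc)
    also have "sqrt r * sqrt r = r" using \<open>r > 0\<close> by simp
    finally have "r * x + y > 0" .
    moreover have "r * x = - (\<bar>y\<bar> + 1)" using \<open>\<not> x \<ge> 0\<close> by (simp add: r_def)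
    ultimately show False by linarith
  qed
  have P: "p A \<ge> 0"
  proof (rule sgn)
    fix u :: real assume "u > 0"
    then have e: "exp (ln u) = u" "exp (- ln u) = 1 / u" by (simp_all add: exp_minus inverse_eq_divide)
    have "u * p A + q A / u = A (ln u)" using At[of "ln u"] unfolding e by simp
    then show "u * p A + q A / u > 0" using Apos[of "ln u"] by linarith
  qed
  have Q: "q A \<ge> 0"
  proof (rule sgn)
    fix u :: real assume "u > 0"
    then have e: "exp (- (- ln u)) = u" "exp (- ln u) = 1 / u" by (simp_all add: exp_minus inverse_eq_divide)
    have "u * q A + p A / u = A (- ln u)" using At[of "- ln u"] unfolding e by simp
    then show "u * q A + p A / u > 0" using Apos[of "- ln u"] by linarith
  qed
  show ?thesis
  proof (rule that)
    show "1 / Im (\<gamma> t) = exp t * p A + exp (-t) * q A" for t by (rule trans[OF AB(1)[symmetric] At])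
    show "Re (\<gamma> t) / Im (\<gamma> t) = exp t * p B + exp (-t) * q B" for t by (rule trans[OF AB(2)[symmetric] Bt])
  qed (use z P Q in simp_all)
qed

lemma semicircle_commute: "semicircle x y = semicircle y x"
  by (auto simp: semicircle_def mult.commute)

lemma hyp_lines_cases:
  assumes "L \<in> hyp_lines"
  shows "(\<exists>x y. x < y \<and> L = semicircle x y) \<or> (\<exists>x. L = vertical x)"
proof -
  obtain \<gamma> where L: "L = range \<gamma>" and up: "\<And>t. Im (\<gamma> t) > 0"
    and iso: "\<And>s t. hyp_dist (\<gamma> s) (\<gamma> t) = \<bar>s - t\<bar>"
    using assms by (auto simp: hyp_lines_def upper_half_plane_def)
  obtain pa pb pc qa qb qc :: real where 
    At: "\<And>t. 1 / Im (\<gamma> t) = exp t * pa + exp (-t) * qa" and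
    Bt: "\<And>t. Re (\<gamma> t) / Im (\<gamma> t) = exp t * pb + exp (-t) * qb" and
    n: "pa * pc = pb\<^sup>2" "qa * qc = qb\<^sup>2" "pa * qc + pc * qa - 2 * pb * qb = 1" and
    nn: "pa \<ge> 0" "qa \<ge> 0"
    using geodesic_param[OF up iso] by metis
  have Apos: "exp t * pa + exp (-t) * qa > 0" for t using up[of t] At[of t] by (metis zero_less_divide_1_iff)
  have Im: "Im (\<gamma> t) = 1 / (exp t * pa + exp (-t) * qa)" for t using At[of t] by (metis div_by_1 divide_divide_eq_right mult_1)
  have Re: "Re (\<gamma> t) = (exp t * pb + exp (-t) * qb) / (exp t * pa + exp (-t) * qa)" for t
  proof -
    have "Re (\<gamma> t) = Re (\<gamma> t) / Im (\<gamma> t) * Im (\<gamma> t)" using up[of t] by simp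
    then show ?thesis unfolding Bt by (simp add: Im)
  qed
  consider "pa = 0" "qa > 0" | "qa = 0" "pa > 0" | "pa > 0" "qa > 0"
    using nn Apos[of 0] by fastforce
  then show ?thesis
  proof cases
    case 1
    then have "pb = 0" using n by simp
    have I: "Im (\<gamma> t) = exp t / qa" and R: "Re (\<gamma> t) = qb / qa" for t
      by (simp_all add: Im Re 1 \<open>pb = 0\<close> exp_minus field_simps)
    have "L = vertical (qb / qa)"
    proof (intro equalityI subsetI)
      fix z assume z: "z \<in> vertical (qb / qa)"
      then have "z = \<gamma> (ln (qa * Im z))" using 1 by (simp add: complex_eq_iff I R vertical_def)
      then show "z \<in> L" using L by blast
    qed (use L I R 1 in \<open>auto simp: vertical_def\<close>)
    then show ?thesis by blast
  next
    case 2
    then have "qb = 0" using n by simp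
    have I: "Im (\<gamma> t) = exp (-t) / pa" and R: "Re (\<gamma> t) = pb / pa" for t
      by (simp_all add: Im Re 2 \<open>qb = 0\<close> exp_minus field_simps)
    have "L = vertical (pb / pa)"
    proof (intro equalityI subsetI)
      fix z assume z: "z \<in> vertical (pb / pa)"
      then have "z = \<gamma> (- ln (pa * Im z))" using 2 by (simp add: complex_eq_iff I R vertical_def)
      then show "z \<in> L" using L by blast
    qed (use L I R 2 in \<open>auto simp: vertical_def\<close>)
    then show ?thesis by blast
  next
    case 3
    define x y where "x = pb / pa" and "y = qb / qa"
    have b: "pb = pa * x" "qb = qa * y" using 3 by (auto simp: x_def y_def)
    have c: "pc = pa * x\<^sup>2" "qc = qa * y\<^sup>2" using n 3 by (simp_all add: b power2_eq_square)
    have d: "pa * qa * (x - y)\<^sup>2 = 1" using n(3) unfolding b c by (simp add: power2_eq_square algebra_simps)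
    then have "x \<noteq> y" by auto
    have on: "(Re (\<gamma> t) - x) * (Re (\<gamma> t) - y) + (Im (\<gamma> t))\<^sup>2 = 0" for t
    proof -
      let ?D = "exp t * pa + exp (-t) * qa"
      have D: "?D > 0" by (rule Apos)
      have 1: "Re (\<gamma> t) - x = exp (-t) * qa * (y - x) / ?D" "Re (\<gamma> t) - y = exp t * pa * (x - y) / ?D"
        using D by (simp_all add: Re b field_simps)
      have "(Re (\<gamma> t) - x) * (Re (\<gamma> t) - y) = - ((exp t * exp (-t)) * (pa * qa * (x - y)\<^sup>2)) / ?D\<^sup>2"
        unfolding 1 by (simp add: power2_eq_square algebra_simps)
      also have "\<dots> = - (1 / ?D\<^sup>2)" unfolding d exp_mult_exp_minus by simp
      finally show ?thesis by (simp add: Im power_divide)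
    qed
    have "L = semicircle x y"
    proof (intro equalityI subsetI)
      fix z assume z: "z \<in> semicircle x y"
      then have neg: "(Re z - x) * (y - Re z) > 0" and zp: "Im z > 0"
      proof -
        show "Im z > 0" using z by (simp add: semicircle_def)
        moreover have "(Re z - x) * (y - Re z) = (Im z)\<^sup>2" using z by (simp add: semicircle_def algebra_simps)
        ultimately show "(Re z - x) * (y - Re z) > 0" by simp
      qed
      have q: "(y - Re z) / (Re z - x) > 0" using neg by (auto simp: zero_less_mult_iff zero_less_divide_iff)
      define E where "E = qa / pa * ((y - Re z) / (Re z - x))"
      have "E > 0" unfolding E_def using q 3 by (intro mult_pos_pos divide_pos_pos[of qa])
      define t where "t = ln E / 2"
      have ee: "exp t * exp t = E" using \<open>E > 0\<close> by (simp add: t_def flip: exp_add)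
      have nz: "Re z - x \<noteq> 0" using neg by auto
      have E: "E * pa * (Re z - x) = qa * (y - Re z)" using nz 3 by (simp add: E_def)
      have D: "exp t * pa + exp (-t) * qa > 0" by (rule Apos)
      have "exp t * (Re z * (exp t * pa + exp (-t) * qa)) = exp t * (exp t * pb + exp (-t) * qb)"
      proof -
        have "exp t * (Re z * (exp t * pa + exp (-t) * qa)) = Re z * ((exp t * exp t) * pa + (exp t * exp (-t)) * qa)"
          by (simp add: algebra_simps)
        also have "\<dots> = E * pa * x + qa * y" using E unfolding ee exp_mult_exp_minus by (simp add: algebra_simps)
        also have "\<dots> = (exp t * exp t) * pb + (exp t * exp (-t)) * qb" unfolding ee exp_mult_exp_minus b by simp
        finally show ?thesis by (simp add: algebra_simps)
      qed
      then have "Re z * (exp t * pa + exp (-t) * qa) = exp t * pb + exp (-t) * qb"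
        by (simp only: mult_left_cancel[OF exp_not_eq_zero])
      then have R: "Re z = Re (\<gamma> t)" using D by (simp add: Re eq_divide_eq)
      have "(Im z)\<^sup>2 = (Im (\<gamma> t))\<^sup>2" using on[of t] z by (simp add: R semicircle_def)
      then have "Im z = Im (\<gamma> t)" using zp up[of t] by (simp add: power2_eq_iff)
      then show "z \<in> L" using L R by (auto simp: complex_eq_iff intro: complex_eqI)
    qed (use on up in \<open>auto simp: semicircle_def L\<close>)
    then show ?thesis using \<open>x \<noteq> y\<close> semicircle_commute[of x y] by (metis linorder_neqE_linordered_idom)
  qed
qed

lemma endpoints_semicircle:
  assumes "x < y" shows "endpoints (semicircle x y) = {Some x, Some y}"
proof -
  let ?K = "{z. (Re z - x) * (Re z - y) + (Im z)\<^sup>2 = 0}"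
  have "closed ?K" by (intro closed_Collect_eq continuous_intros)
  then have sub: "closure (semicircle x y) \<subseteq> ?K" by (intro closure_minimal) (auto simp: semicircle_def)
  have lim: "complex_of_real u \<in> closure (semicircle x y)"
    if u: "\<And>s. 0 < s \<Longrightarrow> s < y - x \<Longrightarrow> Complex (f s) (sqrt (s * (y - x - s))) \<in> semicircle x y"
      and f: "(f \<longlongrightarrow> u) (at_right 0)" for f u
  proof (rule Lim_in_closed_set)
    show "closed (closure (semicircle x y))" by simp
    show "eventually (\<lambda>s. Complex (f s) (sqrt (s * (y - x - s))) \<in> closure (semicircle x y)) (at_right 0)"
      using eventually_at_right_real[of 0 "y - x"] assms
      by (auto elim!: eventually_mono intro!: closure_subset[THEN subsetD] u)
    have "((\<lambda>s. sqrt (s * (y - x - s))) \<longlongrightarrow> sqrt (0 * (y - x - 0))) (at_right 0)"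
      by (intro tendsto_intros)
    then show "((\<lambda>s. Complex (f s) (sqrt (s * (y - x - s)))) \<longlongrightarrow> complex_of_real u) (at_right 0)"
      using tendsto_Complex[OF f] by (fastforce simp: complex_of_real_def)
  qed auto
  have mem: "Complex (x + s) (sqrt (s * (y - x - s))) \<in> semicircle x y"
            "Complex (y - s) (sqrt (s * (y - x - s))) \<in> semicircle x y" if "0 < s" "s < y - x" for s
  proof -
    have "s * (y - x - s) > 0" using that by simp
    then show "Complex (x + s) (sqrt (s * (y - x - s))) \<in> semicircle x y"
              "Complex (y - s) (sqrt (s * (y - x - s))) \<in> semicircle x y"
      by (simp_all only: semicircle_def mem_Collect_eq complex.sel real_sqrt_gt_0_iff real_sqrt_pow2 less_imp_le)
         (simp_all add: algebra_simps)
  qed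
  have 1: "complex_of_real x \<in> closure (semicircle x y)"
  proof (rule lim[where f = "\<lambda>s. x + s"])
    show "((\<lambda>s. x + s) \<longlongrightarrow> x) (at_right 0)" by (auto intro!: tendsto_eq_intros)
  qed (rule mem)
  have 2: "complex_of_real y \<in> closure (semicircle x y)"
  proof (rule lim[where f = "\<lambda>s. y - s"])
    show "((\<lambda>s. y - s) \<longlongrightarrow> y) (at_right 0)" by (auto intro!: tendsto_eq_intros)
  qed (rule mem)
  have "complex_of_real u \<in> closure (semicircle x y) \<longleftrightarrow> u = x \<or> u = y" for u
    using 1 2 sub by auto
  moreover have "bounded (semicircle x y)"
  proof (rule bounded_subset[OF bounded_cball])
    show "semicircle x y \<subseteq> cball (complex_of_real x) (y - x)"
    proof
      fix z assume z: "z \<in> semicircle x y"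
      then have e: "(Im z)\<^sup>2 = (Re z - x) * (y - Re z)" and "Im z > 0" by (auto simp: semicircle_def algebra_simps)
      then have "(Re z - x) * (y - Re z) > 0" by (metis zero_less_power)
      then have "Re z > x" "Re z < y" using assms by (auto simp: zero_less_mult_iff)
      then have "(y - x) * (Re z - x) \<le> (y - x) * (y - x)" using assms by (intro mult_left_mono) auto
      moreover have "(cmod (z - x))\<^sup>2 = (y - x) * (Re z - x)" using e
        unfolding cmod_power2 by (simp add: power2_eq_square algebra_simps)
      ultimately have "(cmod (z - x))\<^sup>2 \<le> (y - x)\<^sup>2" by (simp add: power2_eq_square)
      then have "cmod (z - x) \<le> y - x" by (rule power2_le_imp_le) (use assms in simp)
      then show "z \<in> cball (complex_of_real x) (y - x)" by (simp add: dist_norm norm_minus_commute)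
    qed
  qed
  ultimately show ?thesis by (auto simp: endpoints_def)
qed

lemma endpoints_vertical: "endpoints (vertical x) = {Some x, None}"
proof -
  have "closed {z. Re z = x}" by (intro closed_Collect_eq continuous_intros)
  then have sub: "closure (vertical x) \<subseteq> {z. Re z = x}" by (intro closure_minimal) (auto simp: vertical_def)
  have "complex_of_real x \<in> closure (vertical x)"
  proof (rule Lim_in_closed_set)
    show "eventually (\<lambda>s. Complex x s \<in> closure (vertical x)) (at_right 0)"
      using eventually_at_right_real[of 0 1]
      by (auto elim!: eventually_mono intro!: closure_subset[THEN subsetD] simp: vertical_def)
    show "((\<lambda>s. Complex x s) \<longlongrightarrow> complex_of_real x) (at_right 0)"
      unfolding complex_of_real_def by (intro tendsto_intros)
  qed auto
  then have "complex_of_real u \<in> closure (vertical x) \<longleftrightarrow> u = x" for u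
    using sub by auto
  moreover have "\<not> bounded (vertical x)"
  proof
    assume "bounded (vertical x)"
    then obtain B where B: "\<And>z. z \<in> vertical x \<Longrightarrow> cmod z \<le> B" by (auto simp: bounded_iff)
    have "cmod (Complex x (\<bar>B\<bar> + 1)) \<le> B" by (rule B) (auto simp: vertical_def)
    moreover have "\<bar>Im (Complex x (\<bar>B\<bar> + 1))\<bar> \<le> cmod (Complex x (\<bar>B\<bar> + 1))" by (rule abs_Im_le_cmod)
    ultimately show False by simp
  qed
  ultimately show ?thesis by (auto simp: endpoints_def)
qed

lemma bij_betw_endpoints: "bij_betw endpoints hyp_lines endpoint_pairs"
  unfolding bij_betw_def
proof
  show "inj_on endpoints hyp_lines"
  proof (rule inj_onI)
    fix L M assume "L \<in> hyp_lines" "M \<in> hyp_lines" and eq: "endpoints L = endpoints M"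
    have "\<exists>x y. x < y \<and> L' = semicircle x y \<and> endpoints L' = {Some x, Some y} \<or> L' = vertical x \<and> endpoints L' = {Some x, None}"
      if "L' \<in> hyp_lines" for L'
      using hyp_lines_cases[OF that] endpoints_semicircle endpoints_vertical by metis
    from this[OF \<open>L \<in> hyp_lines\<close>] this[OF \<open>M \<in> hyp_lines\<close>] obtain x y x' y' where
      "x < y \<and> L = semicircle x y \<and> endpoints L = {Some x, Some y} \<or> L = vertical x \<and> endpoints L = {Some x, None}"
      "x' < y' \<and> M = semicircle x' y' \<and> endpoints M = {Some x', Some y'} \<or> M = vertical x' \<and> endpoints M = {Some x', None}"
      by blast
    then show "L = M"
    proof (elim disjE conjE)
      assume *: "x < y" "x' < y'" "endpoints L = {Some x, Some y}" "endpoints M = {Some x', Some y'}"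
        and LM: "L = semicircle x y" "M = semicircle x' y'"
      have "x = x' \<and> y = y' \<or> x = y' \<and> y = x'" using eq unfolding *(3,4) doubleton_eq_iff option.inject .
      then have "x = x'" "y = y'" using *(1,2) by linarith+
      then show "L = M" using LM by simp
    next
      assume *: "endpoints L = {Some x, Some y}" "endpoints M = {Some x', None}"
      have "None \<in> {Some x, Some y}" using eq unfolding * by simp
      then show "L = M" by simp
    next
      assume *: "endpoints L = {Some x, None}" "endpoints M = {Some x', Some y'}"
      have "None \<in> {Some x', Some y'}" using eq unfolding * by auto
      then show "L = M" by simp
    next
      assume *: "endpoints L = {Some x, None}" "endpoints M = {Some x', None}"
        and LM: "L = vertical x" "M = vertical x'"
      have "Some x \<in> {Some x', None}" using eq unfolding * by auto
      then show "L = M" using LM by simp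
    qed
  qed
  show "endpoints ` hyp_lines = endpoint_pairs"
  proof (intro equalityI subsetI)
    fix e assume "e \<in> endpoints ` hyp_lines"
    then show "e \<in> endpoint_pairs"
    proof
      fix L assume L: "e = endpoints L" "L \<in> hyp_lines"
      from hyp_lines_cases[OF L(2)] show ?thesis
      proof (elim disjE exE conjE)
        fix x y :: real assume "x < y" "L = semicircle x y"
        then have "e = {Some x, Some y}" "Some x \<noteq> Some y" using L(1) endpoints_semicircle by simp_all
        then show ?thesis unfolding endpoint_pairs_def by blast
      next
        fix x assume "L = vertical x"
        then have "e = {Some x, None}" "Some x \<noteq> None" using L(1) endpoints_vertical by simp_all
        then show ?thesis unfolding endpoint_pairs_def by blast
      qed
    qed
  next
    fix e assume "e \<in> endpoint_pairs"
    then obtain p q where e: "e = {p, q}" "p \<noteq> q" by (auto simp: endpoint_pairs_def)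
    have "(\<exists>x. e = {Some x, None}) \<or> (\<exists>x y. x < y \<and> e = {Some x, Some y})"
    proof (cases p)
      case None
      then obtain b where "q = Some b" using e(2) by (cases q) auto
      then have "e = {Some b, None}" using e(1) None by blast
      then show ?thesis by blast
    next
      case p: (Some a)
      show ?thesis
      proof (cases q)
        case None
        then have "e = {Some a, None}" using e(1) p by blast
        then show ?thesis by blast
      next
        case q: (Some b)
        then have "e = {Some a, Some b}" "e = {Some b, Some a}" using e(1) p by blast+
        moreover have "a < b \<or> b < a" using e(2) p q by auto
        ultimately show ?thesis by blast
      qed
    qed
    then show "e \<in> endpoints ` hyp_lines"
    proof (elim disjE exE conjE)
      fix x assume "e = {Some x, None}"
      then show ?thesis by (intro image_eqI[of _ _ "vertical x"]) (simp_all only: endpoints_vertical vertical_in_hyp_lines)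
    next
      fix x y assume "e = {Some x, Some y}" "x < y"
      then show ?thesis by (intro image_eqI[of _ _ "semicircle x y"]) (simp_all only: endpoints_semicircle semicircle_in_hyp_lines)
    qed
  qed
qed

lemma line_between:
  assumes "p \<noteq> q"
  shows "line_between p q \<in> hyp_lines" "endpoints (line_between p q) = {p, q}"
proof -
  have inj: "inj_on endpoints hyp_lines" and img: "{p, q} \<in> endpoints ` hyp_lines"
    using bij_betw_endpoints assms unfolding bij_betw_def endpoint_pairs_def by blast+
  show "line_between p q \<in> hyp_lines"
    unfolding line_between_def by (rule the_inv_into_into[OF inj img order_refl])
  show "endpoints (line_between p q) = {p, q}"
    unfolding line_between_def by (rule f_the_inv_into_f[OF inj img])
qed

lemma line_between_in_iff:
  assumes "p \<noteq> q" "A \<subseteq> hyp_lines"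
  shows "line_between p q \<in> A \<longleftrightarrow> {p, q} \<in> endpoints ` A"
proof
  assume "line_between p q \<in> A"
  then show "{p, q} \<in> endpoints ` A" by (rule rev_image_eqI) (simp add: line_between[OF assms(1)])
next
  assume "{p, q} \<in> endpoints ` A"
  then obtain L where "L \<in> A" "{p, q} = endpoints L" by (rule imageE)
  then have L: "L \<in> A" "endpoints L = endpoints (line_between p q)"
    by (simp_all only: line_between(2)[OF assms(1)])
  then have "L = line_between p q"
    using assms(2) line_between(1)[OF assms(1)] bij_betw_imp_inj_on[OF bij_betw_endpoints] by (meson inj_onD subsetD)
  then show "line_between p q \<in> A" using L by simp
qed

lemma space_lines_borel [simp]: "space lines_borel = hyp_lines"
  unfolding lines_borel_def by (intro space_measure_of) auto

lemma measurable_line_between: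
  "(\<lambda>(x, y). line_between (Some x) (Some y)) \<in>
     restrict_space lborel {(x :: real, y :: real). x < y} \<rightarrow>\<^sub>M lines_borel"
  unfolding lines_borel_def
proof (rule measurable_measure_of)
  let ?S = "{(x :: real, y :: real). x < y}"
  fix A assume "A \<in> {A. A \<subseteq> hyp_lines \<and>
         openin (subtopology (prod_topology boundary boundary) {(p, q). p \<noteq> q})
                {(p, q). p \<noteq> q \<and> {p, q} \<in> endpoints ` A}}"
  then have A: "A \<subseteq> hyp_lines" and "openin (subtopology (prod_topology boundary boundary) {(p, q). p \<noteq> q})
                {(p, q). p \<noteq> q \<and> {p, q} \<in> endpoints ` A}" by auto
  then obtain T where T: "openin (prod_topology boundary boundary) T"
      "{(p, q). p \<noteq> q \<and> {p, q} \<in> endpoints ` A} = T \<inter> {(p, q). p \<noteq> q}"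
    by (auto simp: openin_subtopology)
  have "continuous_map (prod_topology euclideanreal euclideanreal) (prod_topology boundary boundary)
          (\<lambda>z. (Some (fst z), Some (snd z)))"
    using continuous_map_compose[OF continuous_map_fst continuous_map_Some]
          continuous_map_compose[OF continuous_map_snd continuous_map_Some]
    by (intro continuous_map_pairedI) (simp_all only: o_def)
  from openin_continuous_map_preimage[OF this T(1)]
  have o: "open {z. (Some (fst z), Some (snd z)) \<in> T}"
    by simp
  have "(\<lambda>(x, y). line_between (Some x) (Some y)) -` A \<inter> space (restrict_space lborel ?S) =
        ?S \<inter> {z. (Some (fst z), Some (snd z)) \<in> T}"
  proof (intro set_eqI)
    fix z :: "real \<times> real"
    obtain x y where z: "z = (x, y)" by force
    show "z \<in> (\<lambda>(x, y). line_between (Some x) (Some y)) -` A \<inter> space (restrict_space lborel ?S) \<longleftrightarrow>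
          z \<in> ?S \<inter> {z. (Some (fst z), Some (snd z)) \<in> T}"
    proof (cases "x < y")
      case True
      then have ne: "Some x \<noteq> Some y" by simp
      have "line_between (Some x) (Some y) \<in> A \<longleftrightarrow> (Some x, Some y) \<in> T"
        unfolding line_between_in_iff[OF ne A] using T(2) ne by blast
      then show ?thesis using True by (simp add: z space_restrict_space)
    qed (simp add: z space_restrict_space)
  qed
  then show "(\<lambda>(x, y). line_between (Some x) (Some y)) -` A \<inter> space (restrict_space lborel ?S)
               \<in> sets (restrict_space lborel ?S)"
    using o by (auto simp: sets_restrict_space)
qed (auto simp: space_restrict_space line_between)

lemma lessthan_pairs_borel: "{(x :: real, y :: real). x < y} \<in> sets borel"
proof -
  have "open {z :: real \<times> real. fst z < snd z}" by (intro open_Collect_less continuous_intros)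
  then show ?thesis by (simp add: case_prod_unfold)
qed

lemma emeasure_Phi:
  assumes "A \<in> sets lines_borel"
  shows "emeasure \<Phi> A =
    (\<integral>\<^sup>+ (x, y). ennreal (1 / (x - y)\<^sup>2) * indicator {(x, y). x < y \<and> line_between (Some x) (Some y) \<in> A} (x, y) \<partial>lborel)"
proof -
  let ?S = "{(x :: real, y :: real). x < y}"
  let ?R = "restrict_space lborel ?S"
  let ?l = "\<lambda>(x, y). line_between (Some x) (Some y)"
  have f: "(\<lambda>(x, y). ennreal (1 / (x - y)\<^sup>2)) \<in> borel_measurable ?R"
    by (intro measurable_restrict_space1) (simp flip: borel_prod)
  have "emeasure \<Phi> A = emeasure (density ?R (\<lambda>(x, y). ennreal (1 / (x - y)\<^sup>2))) (?l -` A \<inter> ?S)"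
    unfolding \<Phi>_def using measurable_line_between assms
    by (subst emeasure_distr) (auto simp: space_restrict_space)
  also have "\<dots> = (\<integral>\<^sup>+ z. (case z of (x, y) \<Rightarrow> ennreal (1 / (x - y)\<^sup>2)) * indicator (?l -` A \<inter> ?S) z \<partial>?R)"
    using f measurable_sets[OF measurable_line_between assms] by (intro emeasure_density) (auto simp: space_restrict_space)
  also have "\<dots> = (\<integral>\<^sup>+ z. (case z of (x, y) \<Rightarrow> ennreal (1 / (x - y)\<^sup>2)) * indicator (?l -` A \<inter> ?S) z * indicator ?S z \<partial>lborel)"
    using lessthan_pairs_borel by (intro nn_integral_restrict_space) simp
  also have "\<dots> = (\<integral>\<^sup>+ (x, y). ennreal (1 / (x - y)\<^sup>2) * indicator {(x, y). x < y \<and> line_between (Some x) (Some y) \<in> A} (x, y) \<partial>lborel)"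
    by (intro nn_integral_cong) (auto simp: indicator_def)
  finally show ?thesis .
qed

lemma lines_to_infinity_null: "{L \<in> hyp_lines. None \<in> endpoints L} \<in> null_sets \<Phi>"
proof -
  let ?N = "{L \<in> hyp_lines. None \<in> endpoints L}"
  let ?F = "range Some :: real option set"
  have o: "openin boundary ?F"
    using openin_Alexandroff_compactification_image_Some[of euclideanreal UNIV] by simp
  have "{(p, q). p \<noteq> q \<and> {p, q} \<in> endpoints ` (hyp_lines - ?N)} = (?F \<times> ?F) \<inter> {(p, q). p \<noteq> q}"
  proof (intro set_eqI iffI)
    fix z assume "z \<in> (?F \<times> ?F) \<inter> {(p, q). p \<noteq> q}"
    then obtain a b where z: "z = (Some a, Some b)" "a \<noteq> b" by auto
    then have "line_between (Some a) (Some b) \<in> hyp_lines - ?N" using line_between[of "Some a" "Some b"] by auto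
    then show "z \<in> {(p, q). p \<noteq> q \<and> {p, q} \<in> endpoints ` (hyp_lines - ?N)}"
      using z line_between(2)[of "Some a" "Some b"] by (auto intro!: image_eqI)
  next
    fix z assume "z \<in> {(p, q). p \<noteq> q \<and> {p, q} \<in> endpoints ` (hyp_lines - ?N)}"
    then obtain p q L where "z = (p, q)" "p \<noteq> q" "endpoints L = {p, q}" "None \<notin> endpoints L" by auto
    then show "z \<in> (?F \<times> ?F) \<inter> {(p, q). p \<noteq> q}" by (cases p; cases q) auto
  qed
  moreover have "openin (prod_topology boundary boundary) (?F \<times> ?F)"
    using o by (simp add: openin_prod_Times_iff)
  ultimately have "openin (subtopology (prod_topology boundary boundary) {(p, q). p \<noteq> q})
                     {(p, q). p \<noteq> q \<and> {p, q} \<in> endpoints ` (hyp_lines - ?N)}"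
    unfolding openin_subtopology by blast
  then have "hyp_lines - ?N \<in> sets lines_borel"
    unfolding lines_borel_def by (intro in_measure_of) blast+
  then have "space lines_borel - (hyp_lines - ?N) \<in> sets lines_borel" by (rule sets.compl_sets)
  moreover have "space lines_borel - (hyp_lines - ?N) = ?N" by auto
  ultimately have N: "?N \<in> sets lines_borel" by simp
  have "\<not> (x < y \<and> line_between (Some x) (Some y) \<in> ?N)" for x y
    using line_between(2)[of "Some x" "Some y"] by auto
  then have e: "{(x, y). x < y \<and> line_between (Some x) (Some y) \<in> ?N} = {}" by blast
  have "emeasure \<Phi> ?N = 0" unfolding emeasure_Phi[OF N] e by (simp add: case_prod_unfold)
  then show ?thesis using N by (intro null_setsI) (simp_all add: \<Phi>_def)
qed

end

theory Submission
  imports Defs "HOL-Real_Asymp.Real_Asymp"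
begin

text \<open>
  Both halves rest on the void probabilities of a Poisson process: a set of lines of finite
  intensity \<open>m\<close> is missed by the process with probability \<open>exp (- m)\<close>, so that missing two sets
  \<open>A\<close> and \<open>B\<close> is positively correlated by the factor \<open>exp (\<mu> (A \<inter> B))\<close>.

  In coordinates the lines of \<open>Y\<close> are semicircles with feet \<open>a < b\<close>, and such a line meets the line
  with feet \<open>x < y\<close> exactly if one of \<open>x\<close>, \<open>y\<close> is in between \<open>a\<close> and \<open>b\<close> and the other is outside
  (or if the two lines agree).  The \<open>\<Phi>\<close>-measure of the lines that separate \<open>x\<close> and \<open>x'\<close> from the
  points at distance one is about \<open>- ln \<bar>x - x'\<bar>\<close>.  Hence the events that points \<open>x\<close> and \<open>x'\<close> of
  the boundary are not covered by short intervals \<open>(a, b)\<close> have correlation factor about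
  \<open>\<bar>x - x'\<bar> powr (- lam)\<close>, and the threshold is the one for integrability of this kernel.

  For \<open>lam \<ge> 1\<close> (lemma \<open>AE_no_vacant_line\<close>) the short intervals cover the whole real axis, as in the
  theorem of Shepp on random coverings of the circle.  Divide an interval into \<open>n\<close> cells.  Intervals
  that cover a cell to the right of the first uncovered cell, but do not cover that first cell, are
  independent of where it is.  Count \<open>2 * n\<close> successive cells,
  each with the inverse of its probability to be uncovered as weight if it is uncovered: the
  expected total is \<open>2 * n\<close>, but given that one of the first \<open>n\<close> cells is uncovered it is at least
  \<open>n * harm n\<close> (lemma \<open>first_void_bound\<close>).  So the probability that one of these is uncovered is at
  most \<open>2 / harm n\<close>, which tends to zero.  Every line has a finite endpoint \<open>x\<close>, and a
  sufficiently short interval of \<open>Y\<close> around \<open>x\<close> belongs to a line that crosses it.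

  For \<open>lam < 1\<close> (lemma \<open>AE_vacant_line\<close>) a second moment argument (lemma \<open>second_moment_bound\<close>) is
  applied to a grid of lines whose endpoints \<open>x\<close> and \<open>y\<close> vary independently in two intervals.  For
  two such lines the correlation factor is at most a constant times
  \<open>\<bar>x - x'\<bar> powr (- lam) * \<bar>y - y'\<bar> powr (- lam)\<close>, which has bounded mean over the grid.  This
  gives vacant lines with positive probability.  To have probability close to one, \<open>k\<close> copies of the
  grid are placed far apart from each other, so that the copies are nearly uncorrelated.  At mesh \<open>1 / n\<close>, apart
  from a fixed set of lines close to those of the grid, which \<open>Y\<close> is required to miss, only lines
  of \<open>Y\<close> that cross a grid line with a margin of \<open>1 / n\<close> count; a line that crosses a limit of
  grid lines crosses nearby grid lines with some margin, so a limit point as \<open>n\<close> tends to infinity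
  is a vacant line (lemma \<open>vacant_line_of_grid_lines\<close>).
\<close>


section \<open>Void probabilities\<close>

lemma point_count_eq_0_iff: "point_count S A = 0 \<longleftrightarrow> S \<inter> A = {}"
proof -
  have "emeasure (count_space UNIV) (S \<inter> A) = 0 \<longleftrightarrow> S \<inter> A \<in> null_sets (count_space UNIV)"
    by (simp add: null_sets_def)
  then show ?thesis by (simp add: point_count_def null_sets_count_space)
qed

definition void :: "'w measure \<Rightarrow> ('w \<Rightarrow> 'a set) \<Rightarrow> 'a set \<Rightarrow> 'w set" where
  "void P Y A = {\<omega> \<in> space P. Y \<omega> \<inter> A = {}}"

lemma void_Un: "void P Y (A \<union> B) = void P Y A \<inter> void P Y B"
  by (auto simp: void_def)

lemma sets_void:
  assumes "poisson_process P M Y" "A \<in> sets M"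
  shows "void P Y A \<in> sets P"
proof -
  have "(\<lambda>\<omega>. point_count (Y \<omega>) A) \<in> borel_measurable P"
    using assms by (simp add: poisson_process_def)
  then have "{\<omega> \<in> space P. point_count (Y \<omega>) A = 0} \<in> sets P"
    by measurable
  then show ?thesis by (simp add: void_def point_count_eq_0_iff)
qed

lemma prob_void:
  assumes "poisson_process P M Y" "A \<in> fmeasurable M"
  shows "measure P (void P Y A) = exp (- measure M A)"
proof -
  have "A \<in> sets M" "emeasure M A < \<infinity>" using assms(2) by (auto simp: fmeasurable_def)
  then have "\<forall>k. measure P {\<omega> \<in> space P. point_count (Y \<omega>) A = of_nat k} =
      measure M A ^ k / fact k * exp (- measure M A)"
    using assms(1) by (simp add: poisson_process_def)
  from this[rule_format, of 0] show ?thesis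
    by (simp add: void_def point_count_eq_0_iff)
qed

lemma prob_void_Int:
  assumes "poisson_process P M Y" "A \<in> fmeasurable M" "B \<in> fmeasurable M"
  shows "measure P (void P Y A \<inter> void P Y B) =
    measure P (void P Y A) * measure P (void P Y B) * exp (measure M (A \<inter> B))"
proof -
  have "measure M (A \<union> B) = measure M A + measure M B - measure M (A \<inter> B)"
    using assms(2,3) by (simp add: measure_Un3)
  moreover have "A \<union> B \<in> fmeasurable M" using assms(2,3) by auto
  ultimately show ?thesis
    using assms by (simp add: prob_void flip: void_Un exp_add)
qed

text \<open>
  Missing \<open>D\<close> is independent of any event that is described by missing or hitting finitely many sets
  disjoint from \<open>D\<close>.  With no set to be hit this is the void probability of a disjoint union; the
  event of hitting one more set \<open>B k\<close> is the difference of two events that have one set less to hit,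
  in the second of which \<open>B k\<close> is added to the missed set \<open>A\<close>.
\<close>

lemma prob_void_indep:
  assumes pp: "poisson_process P M Y" and "finite J"
    and "A \<in> fmeasurable M" "\<And>j. j \<in> J \<Longrightarrow> B j \<in> fmeasurable M" "D \<in> fmeasurable M"
    and "D \<inter> A = {}" "\<And>j. j \<in> J \<Longrightarrow> D \<inter> B j = {}"
  shows "measure P (void P Y A \<inter> void P Y D - (\<Union>j\<in>J. void P Y (B j))) =
         measure P (void P Y A - (\<Union>j\<in>J. void P Y (B j))) * measure P (void P Y D)"
  using assms(2-)
proof (induction J arbitrary: A)
  case empty
  then show ?case using prob_void_Int[OF pp, of A D] by (simp add: Int_commute)
next
  case (insert k J)
  interpret prob_space P using pp by (simp add: poisson_process_def)
  have V: "void P Y C \<in> sets P" if "C \<in> fmeasurable M" for C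
    using that by (intro sets_void[OF pp]) (auto simp: fmeasurable_def)
  let ?U = "\<Union>j\<in>J. void P Y (B j)"
  have U: "?U \<in> sets P" using insert.prems insert.hyps by (intro sets.finite_UN V) auto
  have remove_k: "measure P (W - (\<Union>j\<in>insert k J. void P Y (B j))) =
      measure P (W - ?U) - measure P (W \<inter> void P Y (B k) - ?U)" if "W \<in> sets P" for W
  proof -
    have "W - (\<Union>j\<in>insert k J. void P Y (B j)) = (W - ?U) - (W \<inter> void P Y (B k) - ?U)" by blast
    also have "measure P \<dots> = measure P (W - ?U) - measure P (W \<inter> void P Y (B k) - ?U)"
      using that U V insert.prems by (intro finite_measure_Diff) auto
    finally show ?thesis .
  qed
  have "measure P (void P Y (A \<union> B k) \<inter> void P Y D - ?U) =
      measure P (void P Y (A \<union> B k) - ?U) * measure P (void P Y D)"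
    by (rule insert.IH) (use insert.prems in auto)
  moreover have "measure P (void P Y A \<inter> void P Y D - ?U) =
      measure P (void P Y A - ?U) * measure P (void P Y D)"
    by (rule insert.IH) (use insert.prems in auto)
  moreover have "void P Y A \<inter> void P Y D \<inter> void P Y (B k) = void P Y (A \<union> B k) \<inter> void P Y D"
    by (auto simp: void_Un)
  ultimately show ?case
    using V insert.prems by (subst (1 2) remove_k) (auto simp: void_Un algebra_simps)
qed

text \<open>
  The second moment method.  The number \<open>f\<close> of missed sets, each weighted by the inverse of the
  probability to miss it, has mean \<open>N = card I\<close>, and its second moment is the double sum of the
  correlation factors.  The inequality of Chebyshev takes the form of the pointwise bound
  \<open>1 \<ge> 2 * f / N - (f / N)\<^sup>2\<close>, whose right-hand side vanishes where no set is missed.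
\<close>

lemma second_moment_bound:
  fixes H :: "'i \<Rightarrow> 'a set"
  assumes pp: "poisson_process P M Y" and I: "finite I" "I \<noteq> {}"
    and H: "\<And>i. i \<in> I \<Longrightarrow> H i \<in> fmeasurable M"
    and le: "(\<Sum>i\<in>I. \<Sum>j\<in>I. exp (measure M (H i \<inter> H j))) \<le> (1 + \<delta>) * (real (card I))\<^sup>2"
  shows "measure P (\<Union>i\<in>I. void P Y (H i)) \<ge> 1 - \<delta>"
proof -
  interpret prob_space P using pp by (simp add: poisson_process_def)
  define V where "V i = void P Y (H i)" for i
  define p where "p i = measure P (V i)" for i
  have V: "V i \<in> sets P" if "i \<in> I" for i
    using H[OF that] unfolding V_def by (intro sets_void[OF pp]) (auto simp: fmeasurable_def)
  have p: "p i > 0" if "i \<in> I" for i unfolding p_def V_def prob_void[OF pp H[OF that]] by simp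
  define N where "N = real (card I)"
  have N: "N > 0" using I by (simp add: N_def card_gt_0_iff)
  define f where "f = (\<lambda>\<omega>. \<Sum>i\<in>I. indicator (V i) \<omega> / p i)"
  have sq: "(f \<omega>)\<^sup>2 = (\<Sum>i\<in>I. \<Sum>j\<in>I. indicator (V i \<inter> V j) \<omega> / (p i * p j))" for \<omega>
    by (simp add: f_def power2_eq_square sum_product indicator_inter_arith)
  have int1: "integrable P f" unfolding f_def
    by (intro Bochner_Integration.integrable_sum integrable_divide_zero integrable_real_indicator)
       (use V in \<open>auto simp: emeasure_eq_measure\<close>)
  have int2: "integrable P (\<lambda>\<omega>. (f \<omega>)\<^sup>2)" unfolding sq
    by (intro Bochner_Integration.integrable_sum integrable_divide_zero integrable_real_indicator)
       (use V in \<open>auto simp: emeasure_eq_measure\<close>)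
  have E1: "(\<integral>\<omega>. f \<omega> \<partial>P) = N"
  proof -
    have "(\<integral>\<omega>. f \<omega> \<partial>P) = (\<Sum>i\<in>I. measure P (V i) / p i)" unfolding f_def
      using V by (subst Bochner_Integration.integral_sum)
        (auto intro!: integrable_divide_zero integrable_real_indicator sum.cong simp: emeasure_eq_measure)
    also have "\<dots> = (\<Sum>i\<in>I. 1)" 
    proof (intro sum.cong refl)
      fix i assume "i \<in> I"
      then show "measure P (V i) / p i = 1" using p[of i] by (simp add: p_def)
    qed
    finally show ?thesis by (simp add: N_def)
  qed
  have E2: "(\<integral>\<omega>. (f \<omega>)\<^sup>2 \<partial>P) = (\<Sum>i\<in>I. \<Sum>j\<in>I. exp (measure M (H i \<inter> H j)))"
  proof -
    have "(\<integral>\<omega>. (f \<omega>)\<^sup>2 \<partial>P) = (\<Sum>i\<in>I. \<integral>\<omega>. (\<Sum>j\<in>I. indicator (V i \<inter> V j) \<omega> / (p i * p j)) \<partial>P)"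
      unfolding sq using V by (intro Bochner_Integration.integral_sum Bochner_Integration.integrable_sum integrable_divide_zero
          integrable_real_indicator) (auto simp: emeasure_eq_measure)
    also have "\<dots> = (\<Sum>i\<in>I. \<Sum>j\<in>I. measure P (V i \<inter> V j) / (p i * p j))"
    proof (intro sum.cong refl)
      fix i assume "i \<in> I"
      then show "(\<integral>\<omega>. (\<Sum>j\<in>I. indicator (V i \<inter> V j) \<omega> / (p i * p j)) \<partial>P) = (\<Sum>j\<in>I. measure P (V i \<inter> V j) / (p i * p j))"
        using V by (subst Bochner_Integration.integral_sum)
          (auto intro!: integrable_divide_zero integrable_real_indicator sum.cong simp: emeasure_eq_measure Int_absorb2 sets.sets_into_space)
    qed
    also have "\<dots> = (\<Sum>i\<in>I. \<Sum>j\<in>I. exp (measure M (H i \<inter> H j)))"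
    proof (intro sum.cong refl)
      fix i j assume "i \<in> I" "j \<in> I"
      then show "measure P (V i \<inter> V j) / (p i * p j) = exp (measure M (H i \<inter> H j))"
        using prob_void_Int[OF pp H H, of i j] p[of i] p[of j] by (simp add: V_def p_def)
    qed
    finally show ?thesis .
  qed
  have ptw: "2 / N * f \<omega> - (f \<omega>)\<^sup>2 / N\<^sup>2 \<le> indicator (\<Union>i\<in>I. V i) \<omega>" for \<omega>
  proof (cases "\<omega> \<in> (\<Union>i\<in>I. V i)")
    case True
    have "0 \<le> (f \<omega> / N - 1)\<^sup>2" by simp
    also have "\<dots> = 1 - (2 / N * f \<omega> - (f \<omega>)\<^sup>2 / N\<^sup>2)" by (simp add: power2_eq_square algebra_simps)
    finally show ?thesis using True by simp
  next
    case False
    then have "f \<omega> = 0" by (auto simp: f_def indicator_def intro!: sum.neutral)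
    then show ?thesis by simp
  qed
  have U: "(\<Union>i\<in>I. V i) \<in> sets P" using V I by auto
  have "2 - (1 + \<delta>) \<le> 2 / N * N - (\<Sum>i\<in>I. \<Sum>j\<in>I. exp (measure M (H i \<inter> H j))) / N\<^sup>2"
  proof -
    have "(\<Sum>i\<in>I. \<Sum>j\<in>I. exp (measure M (H i \<inter> H j))) / N\<^sup>2 \<le> 1 + \<delta>"
      using le N by (simp add: N_def[symmetric] pos_divide_le_eq)
    then show ?thesis using N by simp
  qed
  also have "\<dots> = (\<integral>\<omega>. 2 / N * f \<omega> - (f \<omega>)\<^sup>2 / N\<^sup>2 \<partial>P)"
    using int1 int2 by (simp add: E1 E2)
  also have "\<dots> \<le> (\<integral>\<omega>. indicator (\<Union>i\<in>I. V i) \<omega> \<partial>P)"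
    using int1 int2 U by (intro integral_mono ptw) (auto simp: emeasure_eq_measure)
  also have "\<dots> = measure P (\<Union>i\<in>I. V i)" using U by (simp add: sets.sets_into_space Int_absorb2)
  finally show ?thesis by (simp add: V_def)
qed

text \<open>
  A bound on the probability that some of the first \<open>n\<close> sets is missed, by decomposing according to
  the first missed set \<open>H i\<close>.  By assumption \<open>conv\<close>, what \<open>H j\<close> shares with the sets before \<open>H i\<close>
  lies in \<open>H i\<close>, so given that \<open>H i\<close> is the first missed set, \<open>H j\<close> is missed exactly if the
  independent set \<open>H j - H i\<close> is.  Compared with its unconditional value, the
  probability to miss \<open>H j\<close> is thereby increased by the full factor \<open>exp (measure M (H i \<inter> H j))\<close>.
  Summing over \<open>2 * n\<close> sets leaves room for \<open>n\<close> of them after each of the first \<open>n\<close>.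
\<close>

lemma first_void_bound:
  fixes H :: "nat \<Rightarrow> 'a set"
  assumes pp: "poisson_process P M Y"
    and H: "\<And>i. H i \<in> fmeasurable M"
    and conv: "\<And>m i j. m \<le> i \<Longrightarrow> i \<le> j \<Longrightarrow> H m \<inter> H j \<subseteq> H i"
    and S: "\<And>i. i < n \<Longrightarrow> S \<le> (\<Sum>j\<in>{i..<i+n}. exp (measure M (H i \<inter> H j)))"
  shows "measure P (\<Union>i<n. void P Y (H i)) * S \<le> 2 * real n"
proof -
  interpret prob_space P using pp by (simp add: poisson_process_def)
  define V where "V i = void P Y (H i)" for i
  define F where "F i = V i - (\<Union>m<i. V m)" for i
  have V: "V i \<in> sets P" for i
    using H unfolding V_def by (intro sets_void[OF pp]) (auto simp: fmeasurable_def)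
  have F: "F i \<in> sets P" for i unfolding F_def using V by auto
  have p: "measure P (V i) > 0" for i unfolding V_def prob_void[OF pp H] by simp
  have disj: "disjoint_family_on F X" for X
  proof -
    have "F i \<inter> F j = {}" if "i < j" for i j using that by (auto simp: F_def)
    then show ?thesis unfolding disjoint_family_on_def by (metis Int_commute linorder_neqE_nat)
  qed
  have UF: "(\<Union>i<n. V i) \<subseteq> (\<Union>i<n. F i)"
  proof
    fix \<omega> assume "\<omega> \<in> (\<Union>i<n. V i)"
    then obtain i where i: "i < n" "\<omega> \<in> V i" by auto
    define k where "k = (LEAST k. \<omega> \<in> V k)"
    have "\<omega> \<in> V k" "k \<le> i" using i LeastI[of "\<lambda>k. \<omega> \<in> V k" i] Least_le[of "\<lambda>k. \<omega> \<in> V k" i] by (auto simp: k_def)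
    moreover have "\<omega> \<notin> V m" if "m < k" for m using that not_less_Least unfolding k_def by blast
    ultimately show "\<omega> \<in> (\<Union>i<n. F i)" using i by (auto simp: F_def)
  qed
  have FV: "measure P (F i \<inter> V j) / measure P (V j) = measure P (F i) * exp (measure M (H i \<inter> H j))"
    if "i \<le> j" for i j
  proof -
    define D where "D = H j - H i"
    have D: "D \<in> fmeasurable M" "measure M D = measure M (H j) - measure M (H i \<inter> H j)"
    proof -
      show "D \<in> fmeasurable M" using H unfolding D_def by auto
      have "D = H j - H i \<inter> H j" by (auto simp: D_def)
      also have "measure M \<dots> = measure M (H j) - measure M (H i \<inter> H j)"
        using H by (intro measurable_measure_Diff) auto
      finally show "measure M D = measure M (H j) - measure M (H i \<inter> H j)" .
    qed
    have "F i \<inter> V j = void P Y (H i) \<inter> void P Y D - (\<Union>m\<in>{..<i}. void P Y (H m))"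
    proof -
      have "void P Y (H i) \<inter> void P Y (H j) = void P Y (H i) \<inter> void P Y D"
        unfolding void_Un[symmetric] D_def by simp
      then show ?thesis unfolding F_def V_def by blast
    qed
    also have "measure P \<dots> = measure P (void P Y (H i) - (\<Union>m\<in>{..<i}. void P Y (H m))) * measure P (void P Y D)"
    proof (intro prob_void_indep[OF pp] H D finite_lessThan)
      show "D \<inter> H m = {}" if "m \<in> {..<i}" for m
        using conv[of m i j] that \<open>i \<le> j\<close> by (auto simp: D_def)
    qed (auto simp: D_def)
    also have "\<dots> = measure P (F i) * (measure P (V j) * exp (measure M (H i \<inter> H j)))"
      unfolding V_def F_def prob_void[OF pp D(1)] prob_void[OF pp H] D(2) by (simp flip: exp_add)
    finally show ?thesis using p[of j] by simp
  qed
  have "measure P (\<Union>i<n. void P Y (H i)) * S \<le> (\<Sum>i<n. measure P (F i) * S)"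
  proof (cases "S \<ge> 0")
    case True
    have "measure P (\<Union>i<n. V i) \<le> measure P (\<Union>i<n. F i)"
      using UF F by (intro finite_measure_mono) auto
    also have "\<dots> = (\<Sum>i<n. measure P (F i))" using F disj by (intro finite_measure_finite_Union) auto
    finally show ?thesis using True by (simp add: mult_right_mono V_def flip: sum_distrib_right)
  next
    case False
    have "(\<Sum>i<n. measure P (F i)) = measure P (\<Union>i<n. F i)"
      using F disj by (intro finite_measure_finite_Union[symmetric]) auto
    also have "\<dots> \<le> measure P (\<Union>i<n. V i)" using V by (intro finite_measure_mono) (auto simp: F_def)
    finally show ?thesis using False by (simp add: mult_right_mono_neg V_def flip: sum_distrib_right)
  qed
  also have "\<dots> \<le> (\<Sum>i<n. measure P (F i) * (\<Sum>j\<in>{i..<i+n}. exp (measure M (H i \<inter> H j))))"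
    by (intro sum_mono mult_left_mono S) auto
  also have "\<dots> = (\<Sum>i<n. \<Sum>j\<in>{i..<i+n}. measure P (F i \<inter> V j) / measure P (V j))"
    unfolding sum_distrib_left by (intro sum.cong refl FV[symmetric]) simp
  also have "\<dots> \<le> (\<Sum>i<n. \<Sum>j<2*n. measure P (F i \<inter> V j) / measure P (V j))"
    by (intro sum_mono sum_mono2) auto
  also have "\<dots> = (\<Sum>j<2*n. (\<Sum>i<n. measure P (F i \<inter> V j)) / measure P (V j))"
    by (subst sum.swap) (simp add: sum_divide_distrib)
  also have "\<dots> \<le> (\<Sum>j<2*n. 1)"
  proof (intro sum_mono)
    fix j
    have "(\<Sum>i<n. measure P (F i \<inter> V j)) = measure P (\<Union>i<n. F i \<inter> V j)"
      using F V disj[of "{..<n}"] by (intro finite_measure_finite_Union[symmetric]) (force simp: disjoint_family_on_def)+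
    also have "\<dots> \<le> measure P (V j)" using V by (intro finite_measure_mono) auto
    finally show "(\<Sum>i<n. measure P (F i \<inter> V j)) / measure P (V j) \<le> 1" using p[of j] by simp
  qed
  finally show ?thesis by simp
qed

section \<open>Lines and their feet\<close>

text \<open>
  Sets of lines are described by the pairs \<open>a < b\<close> of their feet on the real axis.  Pairs of \<open>S\<close>
  that are not in increasing order are ignored, so \<open>S\<close> may be any convenient region of the plane.
\<close>

definition chords :: "(real \<times> real) set \<Rightarrow> complex set set" where
  "chords S = {semicircle a b |a b. (a, b) \<in> S \<and> a < b}"

lemma semicircle_eq_iff:
  assumes "a < b" "c < d"
  shows "semicircle a b = semicircle c d \<longleftrightarrow> a = c \<and> b = d"
proof
  assume "semicircle a b = semicircle c d"
  then have "{Some a, Some b} = {Some c, Some d}"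
    using assms by (simp flip: endpoints_semicircle)
  then show "a = c \<and> b = d" using assms by (auto simp: doubleton_eq_iff)
qed simp

lemma semicircle_in_chords_iff: "a < b \<Longrightarrow> semicircle a b \<in> chords S \<longleftrightarrow> (a, b) \<in> S"
  unfolding chords_def using semicircle_eq_iff by blast

lemma chords_subset: "chords S \<subseteq> hyp_lines"
  unfolding chords_def using semicircle_in_hyp_lines by blast

lemma chords_mono: "S \<subseteq> T \<Longrightarrow> chords S \<subseteq> chords T"
  unfolding chords_def by blast

lemma chords_Un: "chords (S \<union> T) = chords S \<union> chords T"
  unfolding chords_def by blast

lemma chords_Int: "chords S \<inter> chords T = chords (S \<inter> T)"
proof
  show "chords S \<inter> chords T \<subseteq> chords (S \<inter> T)"
  proof
    fix L assume L: "L \<in> chords S \<inter> chords T"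
    then obtain a b where "L = semicircle a b" "a < b" by (auto simp: chords_def)
    then show "L \<in> chords (S \<inter> T)" using L by (simp add: semicircle_in_chords_iff)
  qed
qed (simp add: chords_mono)

lemma line_between_eq_semicircle:
  assumes "a < b"
  shows "line_between (Some a) (Some b) = semicircle a b"
proof -
  have "Some a \<noteq> Some b" using assms by simp
  then show ?thesis
    using line_between[of "Some a" "Some b"] endpoints_semicircle[OF assms] semicircle_in_hyp_lines[OF assms]
      bij_betw_imp_inj_on[OF bij_betw_endpoints] by (metis inj_onD)
qed

lemma endpoints_chords_iff:
  assumes "p \<noteq> q"
  shows "{p, q} \<in> endpoints ` chords S \<longleftrightarrow>
    (\<exists>a b. a < b \<and> (a, b) \<in> S \<and> (p = Some a \<and> q = Some b \<or> p = Some b \<and> q = Some a))"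
proof
  assume "{p, q} \<in> endpoints ` chords S"
  then obtain a b where "a < b" "(a, b) \<in> S" "{p, q} = endpoints (semicircle a b)"
    unfolding chords_def by blast
  then show "\<exists>a b. a < b \<and> (a, b) \<in> S \<and> (p = Some a \<and> q = Some b \<or> p = Some b \<and> q = Some a)"
    unfolding endpoints_semicircle[OF \<open>a < b\<close>] doubleton_eq_iff by blast
next
  assume "\<exists>a b. a < b \<and> (a, b) \<in> S \<and> (p = Some a \<and> q = Some b \<or> p = Some b \<and> q = Some a)"
  then obtain a b where ab: "a < b" "(a, b) \<in> S" "{p, q} = {Some a, Some b}" by blast
  then show "{p, q} \<in> endpoints ` chords S"
    unfolding ab(3) endpoints_semicircle[OF ab(1), symmetric] by (intro imageI) (auto simp: chords_def)
qed

text \<open>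
  The real part \<open>t\<close> of the intersection point is where the radical axis of the two circles, that is
  the set on which \<open>(t - a) * (t - b) = (t - x) * (t - y)\<close>, meets the real axis.
\<close>

lemma semicircles_meet:
  assumes "a < x" "x < b" "b < y"
  shows "semicircle a b \<inter> semicircle x y \<noteq> {}"
proof -
  define S where "S = x + y - a - b"
  define t where "t = (x * y - a * b) / S"
  define h where "h = (x - a) * (b - x) * (y - a) * (y - b) / S\<^sup>2"
  have S: "S > 0" using assms by (simp add: S_def)
  have h: "h > 0" using S assms by (simp add: h_def)
  have tS: "t * S = x * y - a * b" using S by (simp add: t_def)
  have ab: "(t - x) * S = (x - a) * (b - x)" "(t - y) * S = - ((y - a) * (y - b))"
    unfolding left_diff_distrib tS by (simp_all add: S_def algebra_simps)
  have "((t - x) * (t - y)) * S\<^sup>2 = ((t - x) * S) * ((t - y) * S)"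
    by (simp add: power2_eq_square)
  also have "\<dots> = - (h * S\<^sup>2)" unfolding ab h_def using S by simp
  finally have "((t - x) * (t - y)) * S\<^sup>2 = (- h) * S\<^sup>2" by simp
  then have xy: "(t - x) * (t - y) = - h" using S by (subst (asm) mult_right_cancel) auto
  have "(t - a) * (t - b) - (t - x) * (t - y) = t * S - (x * y - a * b)"
    by (simp add: S_def algebra_simps)
  then have "(t - a) * (t - b) = - h" using tS xy by simp
  then have "Complex t (sqrt h) \<in> semicircle a b \<inter> semicircle x y"
    using xy h by (simp add: semicircle_def)
  then show ?thesis by blast
qed

lemma semicircle_meets_vertical:
  assumes "a < x" "x < b"
  shows "semicircle a b \<inter> vertical x \<noteq> {}"
proof -
  have "(x - a) * (b - x) > 0" using assms by simp
  then have "Complex x (sqrt ((x - a) * (b - x))) \<in> semicircle a b \<inter> vertical x"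
    by (simp add: semicircle_def vertical_def algebra_simps)
  then show ?thesis by blast
qed

text \<open>
  Above a point of the real axis the wider one of two different nested semicircles is strictly
  higher, even if they share a foot; so semicircles that do not cross do not meet.
\<close>

lemma semicircles_meet_imp:
  assumes "x < y" "a < b" "semicircle a b \<inter> semicircle x y \<noteq> {}"
  shows "a < x \<and> x < b \<and> b < y \<or> x < a \<and> a < y \<and> y < b \<or> a = x \<and> b = y"
proof -
  obtain z where z: "z \<in> semicircle a b" "z \<in> semicircle x y" using assms(3) by blast
  have between: "u < Re z \<and> Re z < v" if "u < v" "z \<in> semicircle u v" for u v
  proof -
    have "(Re z - u) * (v - Re z) = (Im z)\<^sup>2" "Im z > 0" using that by (auto simp: semicircle_def algebra_simps)
    then have "(Re z - u) * (v - Re z) > 0" by simp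
    then show ?thesis using that(1) by (auto simp: zero_less_mult_iff)
  qed
  have ab: "a < Re z" "Re z < b" and xy: "x < Re z" "Re z < y" using between assms z by blast+
  have eq: "(Re z - a) * (b - Re z) = (Re z - x) * (y - Re z)"
    using z by (auto simp: semicircle_def algebra_simps)
  have nested: "x' = a' \<and> y' = b'"
    if "a' \<le> x'" "x' < Re z" "Re z < y'" "y' \<le> b'" "(Re z - a') * (b' - Re z) = (Re z - x') * (y' - Re z)"
    for a' b' x' y' :: real
  proof -
    have 1: "(Re z - x') * (y' - Re z) \<le> (Re z - a') * (y' - Re z)"
      using that by (intro mult_right_mono) auto
    have 2: "(Re z - a') * (y' - Re z) \<le> (Re z - a') * (b' - Re z)"
      using that by (intro mult_left_mono) auto
    have "(Re z - x') * (y' - Re z) = (Re z - a') * (y' - Re z)"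
      "(Re z - a') * (y' - Re z) = (Re z - a') * (b' - Re z)" using 1 2 that(5) by linarith+
    then show ?thesis using that by auto
  qed
  have "x = a \<and> y = b" if "a \<le> x" "y \<le> b" using nested[OF that(1) xy that(2) eq] .
  moreover have "a = x \<and> b = y" if "x \<le> a" "b \<le> y" using nested[OF that(1) ab that(2) eq[symmetric]] .
  ultimately show ?thesis using ab xy by linarith
qed

section \<open>The measure of rectangles of lines\<close>

lemma openin_Some_prod:
  assumes "open (U :: (real \<times> real) set)"
  shows "openin (prod_topology boundary boundary) ((\<lambda>(a, b). (Some a, Some b)) ` U)"
  unfolding openin_prod_topology_alt
proof (intro allI impI)
  fix p q assume "(p, q) \<in> (\<lambda>(a, b). (Some a, Some b)) ` U"
  then obtain a b where ab: "p = Some a" "q = Some b" "(a, b) \<in> U" by auto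
  obtain A B where AB: "open A" "open B" "(a, b) \<in> A \<times> B" "A \<times> B \<subseteq> U"
    using open_prod_elim[OF assms ab(3)] by blast
  show "\<exists>V W. openin boundary V \<and> openin boundary W \<and> p \<in> V \<and> q \<in> W \<and> V \<times> W \<subseteq> (\<lambda>(a, b). (Some a, Some b)) ` U"
  proof (intro exI conjI)
    show "openin boundary (Some ` A)" "openin boundary (Some ` B)" using AB by simp_all
  qed (use AB ab in auto)
qed

text \<open>
  A set of ordered pairs of boundary points that corresponds to a set of lines is symmetric, so the
  open set to be exhibited consists of the image of \<open>S\<close> and of its reflection in the diagonal.
\<close>

lemma sets_chords:
  assumes "open S"
  shows "chords S \<in> sets lines_borel"
proof -
  let ?U = "S \<inter> {z. fst z < snd z}"
  let ?V = "{z. (snd z, fst z) \<in> ?U}"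
  have U: "open ?U" by (intro open_Int assms open_Collect_less continuous_intros)
  have "open ((\<lambda>z. (snd z, fst z)) -` ?U)" by (intro open_vimage U continuous_intros)
  then have V: "open ?V" by (simp add: vimage_def)
  let ?T = "(\<lambda>(a, b). (Some a, Some b)) ` ?U \<union> (\<lambda>(a, b). (Some a, Some b)) ` ?V"
  have "{(p, q). p \<noteq> q \<and> {p, q} \<in> endpoints ` chords S} = ?T \<inter> {(p, q). p \<noteq> q}"
  proof (intro set_eqI)
    fix z :: "real option \<times> real option"
    obtain p q where z: "z = (p, q)" by force
    show "z \<in> {(p, q). p \<noteq> q \<and> {p, q} \<in> endpoints ` chords S} \<longleftrightarrow> z \<in> ?T \<inter> {(p, q). p \<noteq> q}"
    proof (cases "p = q")
      case False
      have "(p, q) \<in> ?T \<longleftrightarrow>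
          (\<exists>a b. a < b \<and> (a, b) \<in> S \<and> (p = Some a \<and> q = Some b \<or> p = Some b \<and> q = Some a))"
        by (simp add: image_iff Bex_def) blast
      then show ?thesis using False endpoints_chords_iff[OF False, of S] by (simp add: z)
    qed (simp add: z)
  qed
  moreover have "openin (prod_topology boundary boundary) ?T"
    by (intro openin_Un openin_Some_prod U V)
  ultimately have "openin (subtopology (prod_topology boundary boundary) {(p, q). p \<noteq> q})
      {(p, q). p \<noteq> q \<and> {p, q} \<in> endpoints ` chords S}"
    unfolding openin_subtopology by blast
  then show ?thesis unfolding lines_borel_def by (intro in_measure_of) (use chords_subset in blast)+
qed

lemma sets_Phi [simp]: "sets \<Phi> = sets lines_borel"
  by (simp add: \<Phi>_def)

lemma emeasure_Phi_chords:
  assumes "open S"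
  shows "emeasure \<Phi> (chords S) =
    (\<integral>\<^sup>+ z. ennreal (1 / (fst z - snd z)\<^sup>2) * indicator (S \<inter> {z. fst z < snd z}) z \<partial>(lborel \<Otimes>\<^sub>M lborel))"
proof -
  have "{(x, y). x < y \<and> line_between (Some x) (Some y) \<in> chords S} = S \<inter> {z. fst z < snd z}"
    by (auto simp: line_between_eq_semicircle semicircle_in_chords_iff)
  then show ?thesis
    unfolding emeasure_Phi[OF sets_chords[OF assms]] by (simp add: case_prod_unfold lborel_prod)
qed

lemma nn_integral_inverse_square:
  fixes c d :: real
  assumes "c < d"
  shows "(\<integral>\<^sup>+ x. ennreal (1 / (x - c)\<^sup>2) * indicator {d<..} x \<partial>lborel) = ennreal (1 / (d - c))"
proof -
  \<comment> \<open>Open and closed half-lines differ by a null set.\<close>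
  have "(\<integral>\<^sup>+ x. ennreal (1 / (x - c)\<^sup>2) * indicator {d<..} x \<partial>lborel) =
        (\<integral>\<^sup>+ x. ennreal (1 / (x - c)\<^sup>2) * indicator {d..} x \<partial>lborel)"
    by (intro nn_integral_cong_AE eventually_mono[OF AE_lborel_singleton[of d]]) (auto simp: indicator_def)
  also have "\<dots> = ennreal (0 - (- 1 / (d - c)))"
  proof (rule nn_integral_FTC_atLeast)
    show "((\<lambda>x. - 1 / (x - c)) has_real_derivative 1 / (x - c)\<^sup>2) (at x)" if "d \<le> x" for x
      using that assms by (auto intro!: derivative_eq_intros simp: power2_eq_square)
    show "((\<lambda>x. - 1 / (x - c)) \<longlongrightarrow> 0) at_top"
      by real_asymp
  qed auto
  finally show ?thesis by simp
qed

lemma nn_integral_inverse_square_left: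
  fixes c d :: real
  assumes "d < c"
  shows "(\<integral>\<^sup>+ x. ennreal (1 / (x - c)\<^sup>2) * indicator {..<d} x \<partial>lborel) = ennreal (1 / (c - d))"
proof -
  have "(\<integral>\<^sup>+ x. ennreal (1 / (x - c)\<^sup>2) * indicator {..<d} x \<partial>lborel) =
        (\<integral>\<^sup>+ x. ennreal (1 / (- x - c)\<^sup>2) * indicator {..<d} (- x) \<partial>lborel)"
    by (subst nn_integral_real_affine[where c="-1" and t=0]) auto
  also have "\<dots> = (\<integral>\<^sup>+ x. ennreal (1 / (x - (- c))\<^sup>2) * indicator {-d<..} x \<partial>lborel)"
    by (intro nn_integral_cong) (auto simp: indicator_def power2_eq_square algebra_simps)
  also have "\<dots> = ennreal (1 / (- d - (- c)))" using assms by (intro nn_integral_inverse_square) simp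
  finally show ?thesis by simp
qed

lemma nn_integral_reciprocal:
  fixes c p q :: real
  assumes "c < p" "p \<le> q"
  shows "(\<integral>\<^sup>+ x. ennreal (1 / (x - c)) * indicator {p<..<q} x \<partial>lborel) = ennreal (ln ((q - c) / (p - c)))"
proof -
  have "(\<integral>\<^sup>+ x. ennreal (1 / (x - c)) * indicator {p<..<q} x \<partial>lborel) =
        (\<integral>\<^sup>+ x. ennreal (1 / (x - c)) * indicator {p..q} x \<partial>lborel)"
    by (intro nn_integral_cong_AE eventually_mono[OF eventually_conj[OF AE_lborel_singleton[of p] AE_lborel_singleton[of q]]])
       (auto simp: indicator_def)
  also have "\<dots> = ennreal (ln (q - c) - ln (p - c))"
  proof (rule nn_integral_FTC_Icc)
    show "((\<lambda>x. ln (x - c)) has_real_derivative 1 / (x - c)) (at x)" if "x \<in> {p..q}" for x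
      using that assms by (auto intro!: derivative_eq_intros)
  qed (use assms in auto)
  finally show ?thesis using assms by (simp add: ln_div)
qed

lemma Phi_chords_left:
  assumes "q < r" "r \<le> s"
  shows "emeasure \<Phi> (chords {(a, b). a < q \<and> r < b \<and> b < s}) = ennreal (ln ((s - q) / (r - q)))"
proof -
  let ?S = "{(a, b). a < q \<and> r < b \<and> b < s}"
  have S: "?S = {..<q} \<times> {r<..<s}" by auto
  have "emeasure \<Phi> (chords ?S) =
    (\<integral>\<^sup>+ z. ennreal (1 / (fst z - snd z)\<^sup>2) * indicator (?S \<inter> {z. fst z < snd z}) z \<partial>(lborel \<Otimes>\<^sub>M lborel))"
    unfolding S by (intro emeasure_Phi_chords open_Times) simp_all
  also have "?S \<inter> {z. fst z < snd z} = {..<q} \<times> {r<..<s}" using assms by auto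
  also have "(\<integral>\<^sup>+ z. ennreal (1 / (fst z - snd z)\<^sup>2) * indicator ({..<q} \<times> {r<..<s}) z \<partial>(lborel \<Otimes>\<^sub>M lborel)) =
      (\<integral>\<^sup>+ b. \<integral>\<^sup>+ a. ennreal (1 / (a - b)\<^sup>2) * indicator ({..<q} \<times> {r<..<s}) (a, b) \<partial>lborel \<partial>lborel)"
    by (subst lborel_pair.nn_integral_snd[symmetric]) (auto simp: case_prod_unfold)
  also have "\<dots> = (\<integral>\<^sup>+ b. (\<integral>\<^sup>+ a. ennreal (1 / (a - b)\<^sup>2) * indicator {..<q} a \<partial>lborel) * indicator {r<..<s} b \<partial>lborel)"
    by (intro nn_integral_cong) (auto simp: indicator_def)
  also have "\<dots> = (\<integral>\<^sup>+ b. ennreal (1 / (b - q)) * indicator {r<..<s} b \<partial>lborel)"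
  proof (intro nn_integral_cong)
    fix b :: real
    show "(\<integral>\<^sup>+ a. ennreal (1 / (a - b)\<^sup>2) * indicator {..<q} a \<partial>lborel) * indicator {r<..<s} b =
        ennreal (1 / (b - q)) * indicator {r<..<s} b"
    proof (cases "b \<in> {r<..<s}")
      case True
      then have "q < b" using assms by simp
      then show ?thesis by (simp only: nn_integral_inverse_square_left)
    qed simp
  qed
  also have "\<dots> = ennreal (ln ((s - q) / (r - q)))" by (rule nn_integral_reciprocal[OF assms])
  finally show ?thesis .
qed

lemma Phi_chords_right:
  assumes "p \<le> q" "q < r"
  shows "emeasure \<Phi> (chords {(a, b). p < a \<and> a < q \<and> r < b}) = ennreal (ln ((r - p) / (r - q)))"
proof -
  let ?S = "{(a, b). p < a \<and> a < q \<and> r < b}"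
  have S: "?S = {p<..<q} \<times> {r<..}" by auto
  have "emeasure \<Phi> (chords ?S) =
    (\<integral>\<^sup>+ z. ennreal (1 / (fst z - snd z)\<^sup>2) * indicator (?S \<inter> {z. fst z < snd z}) z \<partial>(lborel \<Otimes>\<^sub>M lborel))"
    unfolding S by (intro emeasure_Phi_chords open_Times) simp_all
  also have "?S \<inter> {z. fst z < snd z} = {p<..<q} \<times> {r<..}" using assms by auto
  also have "(\<integral>\<^sup>+ z. ennreal (1 / (fst z - snd z)\<^sup>2) * indicator ({p<..<q} \<times> {r<..}) z \<partial>(lborel \<Otimes>\<^sub>M lborel)) =
      (\<integral>\<^sup>+ a. \<integral>\<^sup>+ b. ennreal (1 / (a - b)\<^sup>2) * indicator ({p<..<q} \<times> {r<..}) (a, b) \<partial>lborel \<partial>lborel)"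
    by (subst lborel.nn_integral_fst[symmetric]) (auto simp: case_prod_unfold)
  also have "\<dots> = (\<integral>\<^sup>+ a. (\<integral>\<^sup>+ b. ennreal (1 / (b - a)\<^sup>2) * indicator {r<..} b \<partial>lborel) * indicator {p<..<q} a \<partial>lborel)"
    by (intro nn_integral_cong) (auto simp: indicator_def power2_commute)
  also have "\<dots> = (\<integral>\<^sup>+ a. ennreal (1 / (r - a)) * indicator {p<..<q} a \<partial>lborel)"
  proof (intro nn_integral_cong)
    fix a :: real
    show "(\<integral>\<^sup>+ b. ennreal (1 / (b - a)\<^sup>2) * indicator {r<..} b \<partial>lborel) * indicator {p<..<q} a =
        ennreal (1 / (r - a)) * indicator {p<..<q} a"
    proof (cases "a \<in> {p<..<q}")
      case True
      then have "a < r" using assms by simp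
      then show ?thesis by (simp only: nn_integral_inverse_square)
    qed simp
  qed
  also have "\<dots> = (\<integral>\<^sup>+ a. ennreal (1 / (r - (- a))) * indicator {p<..<q} (- a) \<partial>lborel)"
    by (subst nn_integral_real_affine[where c="-1" and t=0]) auto
  also have "\<dots> = (\<integral>\<^sup>+ a. ennreal (1 / (a - (- r))) * indicator {-q<..<-p} a \<partial>lborel)"
    by (intro nn_integral_cong) (auto simp: indicator_def add.commute)
  also have "\<dots> = ennreal (ln ((r - p) / (r - q)))" using assms by (subst nn_integral_reciprocal) auto
  finally show ?thesis .
qed

lemma open_rectangles:
  fixes p q r s :: real
  shows "open {(a, b). a < q \<and> r < b \<and> b < s}" "open {(a, b). p < a \<and> a < q \<and> r < b}"
    "open {(a, b). p < a \<and> a < q \<and> r < b \<and> b < s}"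
proof -
  have "{(a, b). a < q \<and> r < b \<and> b < s} = {..<q} \<times> {r<..<s}"
    "{(a, b). p < a \<and> a < q \<and> r < b} = {p<..<q} \<times> {r<..}"
    "{(a, b). p < a \<and> a < q \<and> r < b \<and> b < s} = {p<..<q} \<times> {r<..<s}" by auto
  then show "open {(a, b). a < q \<and> r < b \<and> b < s}" "open {(a, b). p < a \<and> a < q \<and> r < b}"
    "open {(a, b). p < a \<and> a < q \<and> r < b \<and> b < s}" by (simp_all add: open_Times)
qed

lemma emeasure_Phi_mono: "S \<subseteq> T \<Longrightarrow> open T \<Longrightarrow> emeasure \<Phi> (chords S) \<le> emeasure \<Phi> (chords T)"
  by (intro emeasure_mono chords_mono) (simp_all add: sets_chords)

lemma scaled_Phi:
  assumes "A \<in> sets \<Phi>" "emeasure \<Phi> A = ennreal r" "r \<ge> 0" "lam \<ge> 0"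
  shows "A \<in> fmeasurable (scale_measure (ennreal lam) \<Phi>)"
    and "measure (scale_measure (ennreal lam) \<Phi>) A = lam * r"
proof -
  show "A \<in> fmeasurable (scale_measure (ennreal lam) \<Phi>)"
    using assms by (auto intro!: fmeasurableI simp: ennreal_mult_less_top)
  have "measure \<Phi> A = r" using assms by (simp add: measure_def)
  then show "measure (scale_measure (ennreal lam) \<Phi>) A = lam * r"
    using assms by (simp add: measure_scale_measure)
qed

lemma scaled_Phi_le:
  assumes "open S" "emeasure \<Phi> (chords S) \<le> ennreal r" "0 \<le> r" "0 \<le> lam"
  shows "chords S \<in> fmeasurable (scale_measure (ennreal lam) \<Phi>)"
    and "measure (scale_measure (ennreal lam) \<Phi>) (chords S) \<le> lam * r"
proof -
  have fin: "emeasure \<Phi> (chords S) < \<infinity>" using assms(2) by (simp add: le_less_trans)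
  then show "chords S \<in> fmeasurable (scale_measure (ennreal lam) \<Phi>)"
    using assms by (auto intro!: fmeasurableI simp: ennreal_mult_less_top sets_chords)
  have "measure \<Phi> (chords S) \<le> r"
    using assms(2,3) fin unfolding measure_def by (simp add: enn2real_leI)
  then show "measure (scale_measure (ennreal lam) \<Phi>) (chords S) \<le> lam * r"
    using assms by (simp add: measure_scale_measure mult_left_mono)
qed


section \<open>Large intensity: the boundary is covered\<close>

text \<open>
  The interval from \<open>c\<close> to \<open>c + \<delta>\<close> is divided into \<open>n\<close> cells, and \<open>H i\<close> consists of the lines above
  the cell number \<open>i\<close> whose right foot is less than \<open>c + 3 * \<delta>\<close>.  The lines above the
  cells \<open>i\<close> and \<open>j\<close> are those above everything in between, and they have measure
  \<open>ln ((3 * n - i) / (Suc j - i))\<close>.  For \<open>lam \<ge> 1\<close> the correlation factor is therefore at least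
  \<open>n / (Suc j - i)\<close>, and the sum over \<open>j\<close> diverges like a harmonic sum.
\<close>

lemma prob_uncovered_cell:
  fixes H :: "nat \<Rightarrow> complex set set" and c \<delta> :: real and n :: nat
  assumes pp: "poisson_process P (scale_measure (ennreal lam) \<Phi>) Y"
    and "lam \<ge> 1" "\<delta> > 0" "n > 0"
  defines "H \<equiv> \<lambda>i. chords {(a, b). a < c + \<delta> * i / n \<and> c + \<delta> * Suc i / n < b \<and> b < c + 3 * \<delta>}"
  shows "measure P (\<Union>i<n. void P Y (H i)) * harm n \<le> 2"
proof -
  let ?M = "scale_measure (ennreal lam) \<Phi>"
  let ?T = "\<lambda>i j. {(a, b). a < c + \<delta> * real i / n \<and> c + \<delta> * Suc j / n < b \<and> b < c + 3 * \<delta>}"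
  have x_mono: "c + \<delta> * i / n \<le> c + \<delta> * j / n" if "i \<le> j" for i j :: nat
    using that assms by (simp add: divide_right_mono)
  have T_Int: "?T i i \<inter> ?T j j = ?T i j" if "i \<le> j" for i j
    using x_mono[OF that] x_mono[of "Suc i" "Suc j"] that by auto
  have H_Int: "H i \<inter> H j = chords (?T i j)" if "i \<le> j" for i j
    unfolding H_def chords_Int T_Int[OF that] ..
  have open_T: "open (?T i j)" for i j
  proof -
    have "?T i j = {..<c + \<delta> * real i / n} \<times> {c + \<delta> * Suc j / n<..<c + 3 * \<delta>}" by auto
    then show ?thesis by (simp add: open_Times)
  qed
  have Phi_T: "chords (?T i j) \<in> fmeasurable ?M \<and>
      measure ?M (chords (?T i j)) = lam * ln ((3 * real n - i) / (real (Suc j) - i))" if "i \<le> j" "Suc j \<le> 3 * n" for i j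
  proof -
    have ij: "real i < real (Suc j)" "real (Suc j) \<le> 3 * real n" using that by linarith+
    have "c + \<delta> * real i / n < c + \<delta> * Suc j / n"
      using assms that by (simp add: divide_strict_right_mono)
    moreover have "c + \<delta> * Suc j / n \<le> c + 3 * \<delta>"
    proof -
      have "\<delta> * real (Suc j) \<le> \<delta> * (3 * real n)" using ij assms by (intro mult_left_mono) auto
      then show ?thesis using assms by (simp add: field_simps)
    qed
    ultimately have "emeasure \<Phi> (chords (?T i j)) =
        ennreal (ln ((c + 3 * \<delta> - (c + \<delta> * i / n)) / (c + \<delta> * Suc j / n - (c + \<delta> * i / n))))"
      by (rule Phi_chords_left)
    also have "c + 3 * \<delta> - (c + \<delta> * i / n) = \<delta> / n * (3 * real n - i)"
      using assms by (simp add: field_simps)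
    also have "c + \<delta> * Suc j / n - (c + \<delta> * i / n) = \<delta> / n * (real (Suc j) - i)"
      by (simp add: diff_divide_distrib algebra_simps)
    also have "\<delta> / n * (3 * real n - i) / (\<delta> / n * (real (Suc j) - i)) = (3 * real n - i) / (real (Suc j) - i)"
      using assms by simp
    finally have *: "emeasure \<Phi> (chords (?T i j)) = ennreal (ln ((3 * real n - i) / (real (Suc j) - i)))" .
    have "(3 * real n - i) / (real (Suc j) - i) \<ge> 1" using ij by (simp add: le_divide_eq_1)
    then have "ln ((3 * real n - i) / (real (Suc j) - i)) \<ge> 0" by simp
    with * show ?thesis using scaled_Phi[of "chords (?T i j)" _ lam] sets_chords[OF open_T] assms by auto
  qed
  have Hm: "H i \<in> fmeasurable ?M" for i
  proof (cases "Suc i \<le> 3 * n")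
    case True
    then show ?thesis using Phi_T[of i i] by (simp add: H_def)
  next
    case False
    then have "real (Suc i) > 3 * real n" by linarith
    then have "\<delta> * real (Suc i) > \<delta> * (3 * real n)" using assms by (intro mult_strict_left_mono) auto
    then have "c + \<delta> * Suc i / n > c + 3 * \<delta>" using assms by (simp add: field_simps)
    then have "?T i i = {}" by auto
    then show ?thesis by (simp only: H_def chords_def) simp
  qed
  have "measure P (\<Union>i<n. void P Y (H i)) * (n * harm n) \<le> 2 * real n"
  proof (rule first_void_bound[OF pp Hm])
    show "H m \<inter> H j \<subseteq> H i" if "m \<le> i" "i \<le> j" for m i j
      unfolding H_Int[OF order_trans[OF that]] unfolding H_def
      using x_mono[OF that(1)] x_mono[of "Suc i" "Suc j"] that(2) by (intro chords_mono) auto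
    show "n * harm n \<le> (\<Sum>j\<in>{i..<i+n}. exp (measure ?M (H i \<inter> H j)))" if "i < n" for i
    proof -
      have "n * harm n = (\<Sum>k\<in>{1..n}. real n / k)"
        by (simp add: harm_def sum_distrib_left divide_inverse)
      also have "\<dots> = (\<Sum>j\<in>{i..<i+n}. real n / (Suc j - i))"
        by (rule sum.reindex_bij_witness[of _ "\<lambda>j. Suc j - i" "\<lambda>k. k + i - 1"]) auto
      also have "\<dots> \<le> (\<Sum>j\<in>{i..<i+n}. exp (measure ?M (H i \<inter> H j)))"
      proof (intro sum_mono)
        fix j assume j: "j \<in> {i..<i+n}"
        then have ij: "i \<le> j" "Suc j \<le> 3 * n" using that by auto
        have r: "real (Suc j - i) = real (Suc j) - real i" using ij by simp
        have *: "real n / (Suc j - i) \<le> (3 * real n - i) / (real (Suc j) - i)"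
          unfolding r using that ij by (intro divide_right_mono) auto
        have "1 \<le> real n / (Suc j - i)" using j by simp
        then have 1: "1 \<le> (3 * real n - i) / (real (Suc j) - i)" using * by (rule order_trans)
        then have "ln ((3 * real n - i) / (real (Suc j) - i)) \<le> lam * ln ((3 * real n - i) / (real (Suc j) - i))"
          using mult_right_mono[OF \<open>lam \<ge> 1\<close>, of "ln ((3 * real n - i) / (real (Suc j) - i))"] by simp
        moreover have "exp (ln ((3 * real n - i) / (real (Suc j) - i))) = (3 * real n - i) / (real (Suc j) - i)"
          using 1 by (subst exp_ln) linarith+
        ultimately have "(3 * real n - i) / (real (Suc j) - i) \<le> exp (lam * ln ((3 * real n - i) / (real (Suc j) - i)))"
          by (metis exp_le_cancel_iff)
        then show "real n / (Suc j - i) \<le> exp (measure ?M (H i \<inter> H j))"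
          unfolding H_Int[OF ij(1)] using Phi_T[OF ij] * by simp
      qed
      finally show ?thesis .
    qed
  qed
  then show ?thesis using assms by simp
qed

lemma AE_interval_covered:
  fixes c \<delta> :: real
  assumes pp: "poisson_process P (scale_measure (ennreal lam) \<Phi>) Y"
    and "lam \<ge> 1" "\<delta> > 0"
  shows "AE \<omega> in P. \<forall>x\<in>{c..<c+\<delta>}. \<exists>a b. semicircle a b \<in> Y \<omega> \<and> a < x \<and> x < b \<and> b < c + 3 * \<delta>"
proof -
  interpret prob_space P using pp by (simp add: poisson_process_def)
  define H where "H n i = chords {(a, b). a < c + \<delta> * real i / real n \<and> c + \<delta> * Suc i / real n < b \<and> b < c + 3 * \<delta>}" for n i :: nat
  define U where "U n = (\<Union>i<n. void P Y (H n i))" for n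
  have "H n i \<in> sets \<Phi>" for n i
  proof -
    have "{(a, b). a < c + \<delta> * real i / real n \<and> c + \<delta> * Suc i / real n < b \<and> b < c + 3 * \<delta>} =
        {..<c + \<delta> * real i / n} \<times> {c + \<delta> * Suc i / n<..<c + 3 * \<delta>}" by auto
    then show ?thesis unfolding H_def by (simp add: sets_chords open_Times)
  qed
  then have U: "U n \<in> sets P" for n
    unfolding U_def by (intro sets.finite_UN sets_void[OF pp]) auto
  have le: "measure P (U (Suc n)) \<le> 2 / harm (Suc n)" for n
  proof -
    have "measure P (U (Suc n)) * harm (Suc n) \<le> 2"
      unfolding U_def H_def using assms(2-) by (intro prob_uncovered_cell[OF pp]) auto
    then show ?thesis by (simp add: pos_le_divide_eq harm_pos)
  qed
  have "filterlim (\<lambda>n. harm (Suc n) :: real) at_top sequentially"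
    by (rule filterlim_compose[OF harm_at_top filterlim_Suc])
  then have lim: "(\<lambda>n. 2 / harm (Suc n) :: real) \<longlonglongrightarrow> 0"
    by (intro real_tendsto_divide_at_top[OF tendsto_const])
  have I: "(\<Inter>n. U (Suc n)) \<in> sets P" using U by auto
  have "measure P (\<Inter>n. U (Suc n)) \<le> 2 / harm (Suc n)" for n
    using finite_measure_mono[of "\<Inter>n. U (Suc n)" "U (Suc n)"] U le[of n] by force
  then have "measure P (\<Inter>n. U (Suc n)) \<le> 0"
    by (intro LIMSEQ_le_const[OF lim]) auto
  then have "measure P (\<Inter>n. U (Suc n)) = 0" by (simp add: measure_le_0_iff)
  then have "(\<Inter>n. U (Suc n)) \<in> null_sets P" using I by (simp add: null_sets_def emeasure_eq_measure)
  then have "AE \<omega> in P. \<omega> \<notin> (\<Inter>n. U (Suc n))" by (rule AE_not_in)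
  then show ?thesis
  proof (rule AE_mp, intro AE_I2 impI ballI)
    fix \<omega> x assume \<omega>: "\<omega> \<in> space P" "\<omega> \<notin> (\<Inter>n. U (Suc n))" and x: "x \<in> {c..<c+\<delta>}"
    then obtain n where "\<omega> \<notin> U (Suc n)" by auto
    define m where "m = Suc n"
    define i where "i = nat \<lfloor>(x - c) * m / \<delta>\<rfloor>"
    have pos: "(x - c) * m / \<delta> \<ge> 0" using x assms by simp
    then have "real i = of_int \<lfloor>(x - c) * m / \<delta>\<rfloor>" unfolding i_def by simp
    then have i: "real i \<le> (x - c) * m / \<delta>" "(x - c) * m / \<delta> < real i + 1" by linarith+
    have "(x - c) * m / \<delta> < m" using x assms by (simp add: divide_less_eq m_def)
    then have "i < m" using i by linarith
    then have "Y \<omega> \<inter> H m i \<noteq> {}" using \<open>\<omega> \<notin> U (Suc n)\<close> \<omega> by (auto simp: U_def void_def m_def)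
    then obtain a b where ab: "semicircle a b \<in> Y \<omega>" "a < c + \<delta> * real i / m" "c + \<delta> * Suc i / m < b" "b < c + 3 * \<delta>"
      by (auto simp: H_def chords_def)
    have "c + \<delta> * real i / m \<le> x" "x < c + \<delta> * Suc i / m"
      using i assms by (auto simp: m_def field_simps)
    then show "\<exists>a b. semicircle a b \<in> Y \<omega> \<and> a < x \<and> x < b \<and> b < c + 3 * \<delta>"
      using ab by (intro exI[of _ a] exI[of _ b]) auto
  qed
qed

text \<open>
  The cover is applied at a finite end \<open>x\<close> of the line, the left one if there are two, in an
  interval with rational left end \<open>c\<close> so short that the right feet of the covering lines stay to the
  left of the other end.
\<close>

lemma AE_no_vacant_line:
  assumes pp: "poisson_process P (scale_measure (ennreal lam) \<Phi>) Y" and "lam \<ge> 1"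
  shows "AE \<omega> in P. \<not> (\<exists>L\<in>hyp_lines. L \<subseteq> vacant_set (Y \<omega>))"
proof -
  have "AE \<omega> in P. \<forall>(c :: rat) (k :: nat). \<forall>x\<in>{of_rat c..<of_rat c + 1 / Suc k}.
      \<exists>a b. semicircle a b \<in> Y \<omega> \<and> a < x \<and> x < b \<and> b < of_rat c + 3 * (1 / Suc k)"
    unfolding AE_all_countable using assms by (intro allI AE_interval_covered) auto
  then show ?thesis
  proof (rule AE_mp, intro AE_I2 impI notI)
    fix \<omega> assume cov: "\<forall>(c :: rat) (k :: nat). \<forall>x\<in>{of_rat c..<of_rat c + 1 / Suc k}.
      \<exists>a b. semicircle a b \<in> Y \<omega> \<and> a < x \<and> x < b \<and> b < of_rat c + 3 * (1 / Suc k)"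
    assume "\<exists>L\<in>hyp_lines. L \<subseteq> vacant_set (Y \<omega>)"
    then obtain L where L: "L \<in> hyp_lines" "L \<subseteq> vacant_set (Y \<omega>)" by blast
    have short: "\<exists>a b. semicircle a b \<in> Y \<omega> \<and> a < x \<and> x < b \<and> b < y" if xy: "x < y" for x y
    proof -
      obtain k where k: "1 / real (Suc k) < (y - x) / 3"
        using xy reals_Archimedean[of "(y - x) / 3"] unfolding inverse_eq_divide by auto
      obtain c where c: "x - 1 / Suc k < of_rat c" "of_rat c < x"
        using of_rat_dense[of "x - 1 / Suc k" x] by auto
      then have "x \<in> {of_rat c..<of_rat c + 1 / Suc k}" by auto
      then obtain a b where "semicircle a b \<in> Y \<omega>" "a < x" "x < b" "b < of_rat c + 3 * (1 / Suc k)"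
        using cov by blast
      then show ?thesis using c k by (intro exI[of _ a] exI[of _ b]) auto
    qed
    from hyp_lines_cases[OF L(1)] show False
    proof (elim disjE exE conjE)
      fix x y :: real assume "x < y" "L = semicircle x y"
      then show False using short[OF \<open>x < y\<close>] semicircles_meet[of _ x _ y] L(2)
        unfolding vacant_set_def by blast
    next
      fix x assume "L = vertical x"
      then show False using short[of x "x + 1"] semicircle_meets_vertical[of _ x] L(2)
        unfolding vacant_set_def by fastforce
    qed
  qed
qed

section \<open>Small intensity: a grid of lines\<close>

text \<open>
  The feet of the lines that are considered to block the line from \<open>x\<close> to \<open>y\<close>, where \<open>x\<close> is in
  \<open>{t..t+1}\<close> and \<open>y\<close> is in \<open>{t+2..t+3}\<close>.  The first two sets are the lines that cross it with a
  margin \<open>e\<close>: the margin makes their measure finite.  The third set, which is the same for all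
  \<open>x\<close> and \<open>y\<close>, is a neighbourhood of all these lines; it ensures that a limit of vacant lines is not itself
  a line of the process.
\<close>

definition blockers :: "real \<Rightarrow> real \<Rightarrow> real \<Rightarrow> real \<Rightarrow> (real \<times> real) set" where
  "blockers e t x y =
     {(a, b). a < x - e \<and> x + e < b \<and> b < y - e} \<union>
     {(a, b). x + e < a \<and> a < y - e \<and> y + e < b} \<union>
     {(a, b). t - 1/4 < a \<and> a < t + 5/4 \<and> t + 7/4 < b \<and> b < t + 13/4}"

lemma open_blockers: "open (blockers e t x y)"
  unfolding blockers_def by (intro open_Un open_rectangles)

text \<open>
  A line that blocks two lines of the same family either separates both left ends \<open>x\<close>, \<open>x'\<close> from
  the right ends, or separates both right ends \<open>y\<close>, \<open>y'\<close> from the left ends, where in both cases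
  the measure is a logarithm of the distance, or else has its feet close to \<open>{t..t+1}\<close> and
  \<open>{t+2..t+3}\<close>, which contributes only a constant.
\<close>

lemma Phi_blockers_near:
  assumes "0 < e" "e \<le> 1" "x \<in> {t..t+1}" "x' \<in> {t..t+1}" "y \<in> {t+2..t+3}" "y' \<in> {t+2..t+3}"
  shows "emeasure \<Phi> (chords (blockers e t x y \<inter> blockers e t x' y')) \<le>
    ennreal (ln (4 / (\<bar>x - x'\<bar> + 2 * e)) + ln (4 / (\<bar>y - y'\<bar> + 2 * e)) + ln 4)"
proof -
  let ?A = "{(a, b). a < min x x' - e \<and> max x x' + e < b \<and> b < t + 3}"
  let ?B = "{(a, b). t < a \<and> a < min y y' - e \<and> max y y' + e < b}"
  let ?C = "{(a, b). a < t + 5/4 \<and> t + 7/4 < b \<and> b < t + 13/4}"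
  have sub: "blockers e t x y \<inter> blockers e t x' y' \<subseteq> ?A \<union> ?B \<union> ?C"
  proof
    fix z assume z: "z \<in> blockers e t x y \<inter> blockers e t x' y'"
    obtain a b where ab: "z = (a, b)" by force
    have bounds: "t \<le> x" "x \<le> t + 1" "t \<le> x'" "x' \<le> t + 1" "t + 2 \<le> y" "y \<le> t + 3" "t + 2 \<le> y'" "y' \<le> t + 3"
      using assms by auto
    have 1: "a < x - e \<and> x + e < b \<and> b < y - e \<or> x + e < a \<and> a < y - e \<and> y + e < b \<or>
        a < t + 5/4 \<and> t + 7/4 < b \<and> b < t + 13/4"
      using z by (auto simp: blockers_def ab)
    have 2: "a < x' - e \<and> x' + e < b \<and> b < y' - e \<or> x' + e < a \<and> a < y' - e \<and> y' + e < b \<or>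
        a < t + 5/4 \<and> t + 7/4 < b \<and> b < t + 13/4"
      using z by (auto simp: blockers_def ab)
    consider "a < x - e" "a < x' - e" "x + e < b" "x' + e < b" "b < t + 3"
      | "t < a" "a < y - e" "a < y' - e" "y + e < b" "y' + e < b"
      | "a < t + 5/4" "t + 7/4 < b" "b < t + 13/4"
    proof -
      show ?thesis
        using 1
      proof (elim disjE)
        assume 1: "a < x - e \<and> x + e < b \<and> b < y - e"
        from 2 show ?thesis
        proof (elim disjE)
          assume "a < x' - e \<and> x' + e < b \<and> b < y' - e"
          then show ?thesis using 1 bounds \<open>0 < e\<close> by (intro that(1)) linarith+
        next
          assume "x' + e < a \<and> a < y' - e \<and> y' + e < b"
          then show ?thesis using 1 bounds \<open>0 < e\<close> by (intro that(3)) linarith+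
        qed (blast intro: that(3))
      next
        assume 1: "x + e < a \<and> a < y - e \<and> y + e < b"
        from 2 show ?thesis
        proof (elim disjE)
          assume "a < x' - e \<and> x' + e < b \<and> b < y' - e"
          then show ?thesis using 1 bounds \<open>0 < e\<close> by (intro that(3)) linarith+
        next
          assume "x' + e < a \<and> a < y' - e \<and> y' + e < b"
          then show ?thesis using 1 bounds \<open>0 < e\<close> by (intro that(2)) linarith+
        qed (blast intro: that(3))
      qed (blast intro: that(3))
    qed
    then show "z \<in> ?A \<union> ?B \<union> ?C"
    proof cases
      case 1
      then have "(a, b) \<in> ?A" by (simp add: min_def max_def)
      then show ?thesis unfolding ab by blast
    next
      case 2
      then have "(a, b) \<in> ?B" by (simp add: min_def max_def)
      then show ?thesis unfolding ab by blast
    next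
      case 3
      then have "(a, b) \<in> ?C" by simp
      then show ?thesis unfolding ab by blast
    qed
  qed
  have o: "open ?A" "open ?B" "open ?C" by (intro open_rectangles)+
  have x: "\<bar>x - x'\<bar> \<le> 1" "max x x' - min x x' = \<bar>x - x'\<bar>" "t \<le> min x x'" "max x x' \<le> t + 1"
    and y: "\<bar>y - y'\<bar> \<le> 1" "max y y' - min y y' = \<bar>y - y'\<bar>" "t + 2 \<le> min y y'" "max y y' \<le> t + 3"
    using assms(3-6) by (simp_all add: abs_le_iff max_def min_def)
  have pos: "\<bar>x - x'\<bar> + 2 * e > 0" "\<bar>y - y'\<bar> + 2 * e > 0" using assms by auto
  have A: "emeasure \<Phi> (chords ?A) \<le> ennreal (ln (4 / (\<bar>x - x'\<bar> + 2 * e)))"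
  proof -
    have "emeasure \<Phi> (chords ?A) = ennreal (ln ((t + 3 - (min x x' - e)) / (max x x' + e - (min x x' - e))))"
      using x \<open>0 < e\<close> \<open>e \<le> 1\<close> by (intro Phi_chords_left) linarith+
    also have "max x x' + e - (min x x' - e) = \<bar>x - x'\<bar> + 2 * e" using x by simp
    also have "ennreal (ln ((t + 3 - (min x x' - e)) / (\<bar>x - x'\<bar> + 2 * e))) \<le> ennreal (ln (4 / (\<bar>x - x'\<bar> + 2 * e)))"
    proof (intro ennreal_leI iffD2[OF ln_le_cancel_iff] divide_right_mono divide_pos_pos)
    qed (use pos x y \<open>0 < e\<close> \<open>e \<le> 1\<close> in linarith)+
    finally show ?thesis .
  qed
  have B: "emeasure \<Phi> (chords ?B) \<le> ennreal (ln (4 / (\<bar>y - y'\<bar> + 2 * e)))"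
  proof -
    have "emeasure \<Phi> (chords ?B) = ennreal (ln ((max y y' + e - t) / (max y y' + e - (min y y' - e))))"
      using y \<open>0 < e\<close> \<open>e \<le> 1\<close> by (intro Phi_chords_right) linarith+
    also have "max y y' + e - (min y y' - e) = \<bar>y - y'\<bar> + 2 * e" using y by simp
    also have "ennreal (ln ((max y y' + e - t) / (\<bar>y - y'\<bar> + 2 * e))) \<le> ennreal (ln (4 / (\<bar>y - y'\<bar> + 2 * e)))"
    proof (intro ennreal_leI iffD2[OF ln_le_cancel_iff] divide_right_mono divide_pos_pos)
    qed (use pos x y \<open>0 < e\<close> \<open>e \<le> 1\<close> in linarith)+
    finally show ?thesis .
  qed
  have C: "emeasure \<Phi> (chords ?C) = ennreal (ln 4)"
    by (subst Phi_chords_left) auto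
  have "emeasure \<Phi> (chords (blockers e t x y \<inter> blockers e t x' y')) \<le> emeasure \<Phi> (chords ?A \<union> chords ?B \<union> chords ?C)"
  proof (intro emeasure_mono)
    show "chords (blockers e t x y \<inter> blockers e t x' y') \<subseteq> chords ?A \<union> chords ?B \<union> chords ?C"
      using chords_mono[OF sub] unfolding chords_Un .
    show "chords ?A \<union> chords ?B \<union> chords ?C \<in> sets \<Phi>" using sets_chords o by auto
  qed
  also have "\<dots> \<le> emeasure \<Phi> (chords ?A) + emeasure \<Phi> (chords ?B) + emeasure \<Phi> (chords ?C)"
    using sets_chords o by (intro order_trans[OF emeasure_subadditive add_mono[OF emeasure_subadditive order_refl]]) auto
  also have "\<dots> \<le> ennreal (ln (4 / (\<bar>x - x'\<bar> + 2 * e))) + ennreal (ln (4 / (\<bar>y - y'\<bar> + 2 * e))) + ennreal (ln 4)"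
    using A B C by (intro add_mono) auto
  also have "\<dots> = ennreal (ln (4 / (\<bar>x - x'\<bar> + 2 * e)) + ln (4 / (\<bar>y - y'\<bar> + 2 * e)) + ln 4)"
  proof -
    have "1 \<le> 4 / (\<bar>x - x'\<bar> + 2 * e)" "1 \<le> 4 / (\<bar>y - y'\<bar> + 2 * e)"
    proof -
      have "\<bar>x - x'\<bar> + 2 * e \<le> 1 + 2 * 1" "\<bar>y - y'\<bar> + 2 * e \<le> 1 + 2 * 1"
        by (intro add_mono mult_left_mono x(1) y(1) \<open>e \<le> 1\<close>; simp)+
      then show "1 \<le> 4 / (\<bar>x - x'\<bar> + 2 * e)" "1 \<le> 4 / (\<bar>y - y'\<bar> + 2 * e)"
        by (simp_all only: pos_le_divide_eq[OF pos(1)] pos_le_divide_eq[OF pos(2)]) simp_all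
    qed
    then have "0 \<le> ln (4 / (\<bar>x - x'\<bar> + 2 * e))" "0 \<le> ln (4 / (\<bar>y - y'\<bar> + 2 * e))" by (simp_all only: ln_ge_zero)
    moreover have "ennreal a + ennreal b + ennreal c = ennreal (a + b + c)"
      if "0 \<le> a" "0 \<le> b" "0 \<le> c" for a b c using that by simp
    ultimately show ?thesis by simp
  qed
  finally show ?thesis .
qed

text \<open>
  A line that blocks two lines of distant families has one foot between \<open>x\<close> and \<open>y\<close> and the other
  one beyond \<open>x'\<close>.
\<close>

lemma Phi_blockers_far:
  assumes "0 < e" "e \<le> 1" "x \<in> {t..t+1}" "x' \<in> {t'..t'+1}" "y \<in> {t+2..t+3}" "y' \<in> {t'+2..t'+3}"
    and "t + 4 \<le> t'"
  shows "emeasure \<Phi> (chords (blockers e t x y \<inter> blockers e t' x' y')) \<le> ennreal (ln (1 + 3 / (t' - t - 3)))"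
proof -
  have "blockers e t x y \<inter> blockers e t' x' y' \<subseteq> {(a, b). x < a \<and> a < y \<and> x' < b}"
  proof
    fix z assume z: "z \<in> blockers e t x y \<inter> blockers e t' x' y'"
    obtain a b where ab: "z = (a, b)" by force
    have bounds: "t \<le> x" "x \<le> t + 1" "t' \<le> x'" "x' \<le> t' + 1" "t + 2 \<le> y" "y \<le> t + 3" "t' + 2 \<le> y'" "y' \<le> t' + 3"
      using assms by auto
    have "a < x - e \<and> x + e < b \<and> b < y - e \<or> x + e < a \<and> a < y - e \<and> y + e < b \<or>
        a < t + 5/4 \<and> t + 7/4 < b \<and> b < t + 13/4"
      using z by (auto simp: blockers_def ab)
    moreover have "a < x' - e \<and> x' + e < b \<and> b < y' - e \<or> x' + e < a \<and> a < y' - e \<and> y' + e < b \<or>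
        t' - 1/4 < a \<and> t' + 7/4 < b"
      using z by (auto simp: blockers_def ab)
    ultimately have "x < a \<and> a < y \<and> x' < b"
      using bounds \<open>0 < e\<close> \<open>t + 4 \<le> t'\<close> by linarith
    then show "z \<in> {(a, b). x < a \<and> a < y \<and> x' < b}" by (simp add: ab)
  qed
  then have "emeasure \<Phi> (chords (blockers e t x y \<inter> blockers e t' x' y')) \<le>
      emeasure \<Phi> (chords {(a, b). x < a \<and> a < y \<and> x' < b})"
    by (intro emeasure_Phi_mono open_rectangles)
  also have "\<dots> = ennreal (ln ((x' - x) / (x' - y)))"
    using assms by (intro Phi_chords_right) auto
  also have "(x' - x) / (x' - y) = 1 + (y - x) / (x' - y)" using assms by (simp add: field_simps)
  also have "ennreal (ln (1 + (y - x) / (x' - y))) \<le> ennreal (ln (1 + 3 / (t' - t - 3)))"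
  proof -
    have xy: "0 \<le> y - x" "y - x \<le> 3" "0 < t' - t - 3" "t' - t - 3 \<le> x' - y" using assms by auto
    then have "(y - x) / (x' - y) \<le> 3 / (t' - t - 3)" by (intro frac_le) auto
    moreover have "0 \<le> (y - x) / (x' - y)" using xy by (intro divide_nonneg_nonneg) linarith+
    ultimately show ?thesis by (intro ennreal_leI ln_mono) linarith+
  qed
  finally show ?thesis .
qed

text \<open>
  Comparison with the integral of the function \<open>s powr (- l)\<close>.  Each step is the tangent inequality
  for the concave function \<open>s powr (1 - l)\<close>, here from the weighted
  inequality of arithmetic and geometric means.
\<close>

lemma sum_powr_le:
  fixes l :: real
  assumes "0 < l" "l < 1"
  shows "(\<Sum>d<n. (real d + 1) powr (- l)) \<le> real n powr (1 - l) / (1 - l)"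
proof (induction n)
  case 0
  then show ?case by simp
next
  case (Suc n)
  have step: "(1 - l) * (real n + 1) powr (- l) \<le> (real n + 1) powr (1 - l) - real n powr (1 - l)"
  proof (cases "n = 0")
    case True
    then show ?thesis using assms by simp
  next
    case False
    have "real n powr (1 - l) * (real n + 1) powr l \<le> (1 - l) * real n + l * (real n + 1)"
      using assms False by (intro Youngs_inequality_0) auto
    then have "real n powr (1 - l) * (real n + 1) powr l * (real n + 1) powr (- l) \<le>
        ((1 - l) * real n + l * (real n + 1)) * (real n + 1) powr (- l)"
      by (intro mult_right_mono) auto
    also have "\<dots> = (real n + 1) powr 1 * (real n + 1) powr (- l) - (1 - l) * (real n + 1) powr (- l)"
      by (simp add: algebra_simps)
    also have "(real n + 1) powr 1 * (real n + 1) powr (- l) = (real n + 1) powr (1 - l)"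
      by (simp only: powr_add[symmetric]) simp
    also have "real n powr (1 - l) * (real n + 1) powr l * (real n + 1) powr (- l) = real n powr (1 - l)"
      by (simp add: mult.assoc flip: powr_add)
    finally show ?thesis by linarith
  qed
  have "(\<Sum>d<Suc n. (real d + 1) powr (- l)) \<le> real n powr (1 - l) / (1 - l) + (real n + 1) powr (- l)"
    using Suc by simp
  moreover have "(real n + 1) powr (- l) \<le> ((real n + 1) powr (1 - l) - real n powr (1 - l)) / (1 - l)"
    using step assms by (simp add: pos_le_divide_eq mult.commute)
  moreover have "real n powr (1 - l) / (1 - l) + ((real n + 1) powr (1 - l) - real n powr (1 - l)) / (1 - l) =
      real (Suc n) powr (1 - l) / (1 - l)"
    by (simp add: diff_divide_distrib add.commute)
  ultimately show ?case by linarith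
qed

lemma sum_kernel_le:
  fixes l :: real
  assumes "0 < l" "l < 1" "u < n"
  shows "(\<Sum>v<n. (n / (\<bar>real u - real v\<bar> + 1)) powr l) \<le> 2 * real n / (1 - l)"
proof -
  let ?h = "\<lambda>d::nat. (real n / (real d + 1)) powr l"
  have half: "(\<Sum>v\<in>A. (n / (\<bar>real u - real v\<bar> + 1)) powr l) \<le> (\<Sum>d<n. ?h d)"
    if f: "inj_on f A" "f ` A \<subseteq> {..<n}" "\<And>v. v \<in> A \<Longrightarrow> \<bar>real u - real v\<bar> = real (f v)" for A f
  proof -
    have "(\<Sum>v\<in>A. (n / (\<bar>real u - real v\<bar> + 1)) powr l) = (\<Sum>v\<in>A. ?h (f v))"
      using f(3) by (intro sum.cong) auto
    also have "\<dots> = (\<Sum>d\<in>f ` A. ?h d)" using f(1) by (simp add: sum.reindex)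
    also have "\<dots> \<le> (\<Sum>d<n. ?h d)" using f(2) by (intro sum_mono2) auto
    finally show ?thesis .
  qed
  have total: "(\<Sum>d<n. ?h d) \<le> n / (1 - l)"
  proof -
    have "(\<Sum>d<n. ?h d) = n powr l * (\<Sum>d<n. (real d + 1) powr (- l))"
      unfolding sum_distrib_left by (intro sum.cong) (auto simp: powr_divide powr_minus_divide)
    also have "\<dots> \<le> n powr l * (n powr (1 - l) / (1 - l))"
      by (intro mult_left_mono sum_powr_le assms) auto
    also have "\<dots> = n / (1 - l)" using assms by (simp flip: powr_add)
    finally show ?thesis .
  qed
  have "(\<Sum>v<n. (n / (\<bar>real u - real v\<bar> + 1)) powr l) =
      (\<Sum>v\<in>{..u}. (n / (\<bar>real u - real v\<bar> + 1)) powr l) + (\<Sum>v\<in>{u<..<n}. (n / (\<bar>real u - real v\<bar> + 1)) powr l)"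
    using assms by (subst sum.union_disjoint[symmetric]) (auto intro!: sum.cong)
  also have "\<dots> \<le> (\<Sum>d<n. ?h d) + (\<Sum>d<n. ?h d)"
  proof (intro add_mono)
    show "(\<Sum>v\<in>{..u}. (n / (\<bar>real u - real v\<bar> + 1)) powr l) \<le> (\<Sum>d<n. ?h d)"
      using assms by (intro half[of "\<lambda>v. u - v"]) (auto simp: inj_on_def)
    show "(\<Sum>v\<in>{u<..<n}. (n / (\<bar>real u - real v\<bar> + 1)) powr l) \<le> (\<Sum>d<n. ?h d)"
      using assms by (intro half[of "\<lambda>v. v - u"]) (auto simp: inj_on_def)
  qed
  also have "\<dots> \<le> 2 * real n / (1 - l)" using total by simp
  finally show ?thesis .
qed

text \<open>
  The blockers at margin \<open>1 / n\<close> of the line number \<open>(u, v)\<close> in the family number \<open>i\<close>.  The spacing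
  \<open>3 * k + 3\<close> of the families keeps lines of different families at distance at least \<open>3 * k\<close>, which
  makes their correlation factor at most \<open>1 + 1 / k\<close>.
\<close>

definition grid :: "nat \<Rightarrow> nat \<Rightarrow> nat \<times> nat \<times> nat \<Rightarrow> (real \<times> real) set" where
  "grid k n = (\<lambda>(i, u, v). let t = (3 * real k + 3) * i in blockers (1 / n) t (t + u / n) (t + 2 + v / n))"

lemma grid_measure_near:
  fixes lam :: real
  assumes lam: "0 < lam" "lam < 1" and "u < n" "v < n" "u' < n" "v' < n"
  shows "chords (grid k n (i, u, v) \<inter> grid k n (i, u', v')) \<in> fmeasurable (scale_measure (ennreal lam) \<Phi>)"
    and "exp (measure (scale_measure (ennreal lam) \<Phi>) (chords (grid k n (i, u, v) \<inter> grid k n (i, u', v'))))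
      \<le> 64 * ((n / (\<bar>real u - real u'\<bar> + 1)) powr lam * (n / (\<bar>real v - real v'\<bar> + 1)) powr lam)"
proof -
  define t where "t = (3 * real k + 3) * i"
  define x where "x = (\<lambda>u::nat. t + u / n)"
  define y where "y = (\<lambda>v::nat. t + 2 + v / n)"
  have n: "real n > 0" using assms by simp
  have fr: "0 \<le> real w / n" "real w / n \<le> 1" if "w < n" for w :: nat
    using that by simp_all
  define A where "A = (\<lambda>w w' :: nat. 4 / (\<bar>real w - real w'\<bar> / n + 2 * (1 / n)))"
  have A: "0 < A w w'" "1 \<le> A w w'" "A w w' powr lam \<le> 4 * (n / (\<bar>real w - real w'\<bar> + 1)) powr lam"
    if "w < n" "w' < n" for w w'
  proof -
    have "\<bar>real w - real w'\<bar> / n + 2 * (1 / n) = (\<bar>real w - real w'\<bar> + 2) / n"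
      by (simp add: add_divide_distrib)
    then have eq: "A w w' = 4 * (n / (\<bar>real w - real w'\<bar> + 2))" by (simp add: A_def)
    have "\<bar>real w - real w'\<bar> + 2 \<le> 4 * real n" using that by linarith
    then show 1: "1 \<le> A w w'" unfolding eq by (simp add: pos_le_divide_eq)
    then show "0 < A w w'" by simp
    have "A w w' \<le> 4 * (n / (\<bar>real w - real w'\<bar> + 1))"
      unfolding eq by (intro mult_left_mono divide_left_mono) auto
    then have "A w w' powr lam \<le> (4 * (n / (\<bar>real w - real w'\<bar> + 1))) powr lam"
      using lam 1 by (intro powr_mono2) auto
    also have "\<dots> = 4 powr lam * (n / (\<bar>real w - real w'\<bar> + 1)) powr lam"
      by (rule powr_mult)
    also have "\<dots> \<le> 4 powr 1 * (n / (\<bar>real w - real w'\<bar> + 1)) powr lam"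
      using lam by (intro mult_right_mono powr_mono) auto
    finally show "A w w' powr lam \<le> 4 * (n / (\<bar>real w - real w'\<bar> + 1)) powr lam" by simp
  qed
  have dist: "\<bar>x u - x u'\<bar> = \<bar>real u - real u'\<bar> / n" "\<bar>y v - y v'\<bar> = \<bar>real v - real v'\<bar> / n"
    by (simp_all add: x_def y_def flip: diff_divide_distrib)
  have S: "grid k n (i, u, v) \<inter> grid k n (i, u', v') =
      blockers (1 / n) t (x u) (y v) \<inter> blockers (1 / n) t (x u') (y v')"
    by (simp add: grid_def Let_def t_def x_def y_def)
  have le: "emeasure \<Phi> (chords (grid k n (i, u, v) \<inter> grid k n (i, u', v'))) \<le>
      ennreal (ln (A u u') + ln (A v v') + ln 4)"
    unfolding S A_def dist[symmetric] using fr assms n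
    by (intro Phi_blockers_near) (auto simp: x_def y_def)
  have ln0: "0 \<le> ln (A u u')" "0 \<le> ln (A v v')" using A assms by (simp_all add: ln_ge_zero)
  have "open (grid k n (i, u, v) \<inter> grid k n (i, u', v'))" unfolding S by (intro open_Int open_blockers)
  note * = scaled_Phi_le[OF this le, of lam]
  show "chords (grid k n (i, u, v) \<inter> grid k n (i, u', v')) \<in> fmeasurable (scale_measure (ennreal lam) \<Phi>)"
    using *(1) ln0 lam by simp
  have "exp (measure (scale_measure (ennreal lam) \<Phi>) (chords (grid k n (i, u, v) \<inter> grid k n (i, u', v'))))
      \<le> exp (lam * (ln (A u u') + ln (A v v') + ln 4))"
    using *(2) ln0 lam by simp
  \<comment> \<open>Each of the three factors gives at most a factor 4 besides the kernel, as \<open>lam < 1\<close>.\<close>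
  also have "\<dots> = A u u' powr lam * A v v' powr lam * 4 powr lam"
    using A(1)[of u u'] A(1)[of v v'] assms by (simp add: powr_def ring_distribs flip: exp_add)
  also have "\<dots> \<le> (4 * (n / (\<bar>real u - real u'\<bar> + 1)) powr lam) * (4 * (n / (\<bar>real v - real v'\<bar> + 1)) powr lam) * 4 powr 1"
    using A assms by (intro mult_mono powr_mono) auto
  finally show "exp (measure (scale_measure (ennreal lam) \<Phi>) (chords (grid k n (i, u, v) \<inter> grid k n (i, u', v'))))
      \<le> 64 * ((n / (\<bar>real u - real u'\<bar> + 1)) powr lam * (n / (\<bar>real v - real v'\<bar> + 1)) powr lam)"
    by simp
qed

lemma grid_measure_far:
  fixes lam :: real
  assumes lam: "0 < lam" "lam < 1" and "u < n" "v < n" "u' < n" "v' < n" and k: "k > 0" and "i < i'"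
  shows "exp (measure (scale_measure (ennreal lam) \<Phi>) (chords (grid k n (i, u, v) \<inter> grid k n (i', u', v'))))
      \<le> 1 + 1 / k"
proof -
  define t where "t = (\<lambda>i::nat. (3 * real k + 3) * i)"
  have "real i' \<ge> real i + 1" using \<open>i < i'\<close> by linarith
  then have "(3 * real k + 3) * real i' \<ge> (3 * real k + 3) * (real i + 1)" by (intro mult_left_mono) auto
  then have gap: "t i' - t i - 3 \<ge> 3 * k" by (simp add: t_def algebra_simps)
  have n: "real n > 0" "1 / real n \<le> 1" using assms by simp_all
  have fr: "0 \<le> real w / n" "real w / n \<le> 1" if "w < n" for w :: nat
    using that by simp_all
  have S: "grid k n (i, u, v) \<inter> grid k n (i', u', v') =
      blockers (1 / n) (t i) (t i + u / n) (t i + 2 + v / n) \<inter> blockers (1 / n) (t i') (t i' + u' / n) (t i' + 2 + v' / n)"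
    by (simp add: grid_def Let_def t_def)
  have le: "emeasure \<Phi> (chords (grid k n (i, u, v) \<inter> grid k n (i', u', v'))) \<le>
      ennreal (ln (1 + 3 / (t i' - t i - 3)))"
    unfolding S using fr assms(3-6) n gap k
    by (intro Phi_blockers_far) auto
  have k3: "3 * real k > 0" using k by simp
  have "0 < t i' - t i - 3" using gap k3 by linarith
  then have pos: "0 < 3 / (t i' - t i - 3)" by (intro divide_pos_pos) auto
  then have ln0: "0 \<le> ln (1 + 3 / (t i' - t i - 3))" by simp
  have "open (grid k n (i, u, v) \<inter> grid k n (i', u', v'))" unfolding S by (intro open_Int open_blockers)
  then have "measure (scale_measure (ennreal lam) \<Phi>) (chords (grid k n (i, u, v) \<inter> grid k n (i', u', v')))
      \<le> lam * ln (1 + 3 / (t i' - t i - 3))"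
    using lam ln0 by (intro scaled_Phi_le(2)[OF _ le]) auto
  also have "\<dots> \<le> ln (1 + 3 / (t i' - t i - 3))" using ln0 lam by (simp add: mult_left_le_one_le)
  finally have "exp (measure (scale_measure (ennreal lam) \<Phi>) (chords (grid k n (i, u, v) \<inter> grid k n (i', u', v'))))
      \<le> exp (ln (1 + 3 / (t i' - t i - 3)))" by simp
  also have "\<dots> = 1 + 3 / (t i' - t i - 3)" using pos by (intro exp_ln) linarith
  also have "\<dots> \<le> 1 + 3 / (3 * real k)" using gap k3 by (intro add_left_mono divide_left_mono mult_pos_pos) auto
  finally show ?thesis by simp
qed

text \<open>
  The bound is uniform in \<open>n\<close>: within a family the correlation factors have bounded mean, because the
  kernel \<open>\<bar>x - x'\<bar> powr (- lam)\<close> is integrable for \<open>lam < 1\<close>, and pairs within one family are a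
  fraction \<open>1 / k\<close> of all pairs.
\<close>

lemma prob_grid_vacant:
  fixes lam :: real and k n :: nat
  assumes pp: "poisson_process P (scale_measure (ennreal lam) \<Phi>) Y"
    and lam: "0 < lam" "lam < 1" and k: "k > 0" and n: "n > 0"
  shows "1 - ((16 / (1 - lam))\<^sup>2 + 1) / k \<le>
    measure P (\<Union>p\<in>{..<k} \<times> {..<n} \<times> {..<n}. void P Y (chords (grid k n p)))"
proof (rule second_moment_bound[OF pp])
  let ?I = "{..<k} \<times> {..<n} \<times> {..<n}"
  let ?M = "scale_measure (ennreal lam) \<Phi>"
  let ?g = "\<lambda>w w' :: nat. (n / (\<bar>real w - real w'\<bar> + 1)) powr lam"
  let ?C = "(16 / (1 - lam))\<^sup>2"
  show "finite ?I" "?I \<noteq> {}" using k n by auto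
  show "chords (grid k n p) \<in> fmeasurable ?M" if "p \<in> ?I" for p
    using that grid_measure_near(1)[OF lam, of "fst (snd p)" n "snd (snd p)" "fst (snd p)" "snd (snd p)" k "fst p"]
    by auto
  have pair: "exp (measure ?M (chords (grid k n (i, u, v)) \<inter> chords (grid k n (i', u', v'))))
      \<le> of_bool (i' = i) * (64 * (?g u u' * ?g v v')) + (1 + 1 / k)"
    if "u < n" "v < n" "u' < n" "v' < n" for i u v i' u' v'
  proof -
    consider "i = i'" | "i < i'" | "i' < i" by linarith
    then show ?thesis
    proof cases
      case 1
      then show ?thesis using grid_measure_near(2)[OF lam that, of k i] by (simp add: chords_Int add_increasing2)
    next
      case 2
      then show ?thesis using grid_measure_far[OF lam that k, of i i'] by (simp add: chords_Int)
    next
      case 3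
      then show ?thesis using grid_measure_far[OF lam that(3,4,1,2) k, of i' i] by (simp add: chords_Int Int_commute)
    qed
  qed
  have row: "(\<Sum>q\<in>?I. exp (measure ?M (chords (grid k n p) \<inter> chords (grid k n q))))
      \<le> ?C * (real n)\<^sup>2 + (1 + 1 / k) * (k * (real n)\<^sup>2)" if "p \<in> ?I" for p
  proof -
    obtain i u v where p: "p = (i, u, v)" "i < k" "u < n" "v < n" using \<open>p \<in> ?I\<close> by auto
    have "(\<Sum>q\<in>?I. exp (measure ?M (chords (grid k n p) \<inter> chords (grid k n q))))
        \<le> (\<Sum>(i', u', v')\<in>?I. of_bool (i' = i) * (64 * (?g u u' * ?g v v')) + (1 + 1 / k))"
      using pair p by (intro sum_mono) auto
    also have "\<dots> = (\<Sum>(i', u', v')\<in>?I. of_bool (i' = i) * (64 * (?g u u' * ?g v v'))) + (1 + 1 / k) * (k * (real n)\<^sup>2)"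
      by (simp add: case_prod_unfold sum.distrib power2_eq_square)
    also have "(\<Sum>(i', u', v')\<in>?I. of_bool (i' = i) * (64 * (?g u u' * ?g v v'))) =
        (\<Sum>i'<k. of_bool (i' = i) * (\<Sum>u'<n. \<Sum>v'<n. 64 * (?g u u' * ?g v v')))"
      by (simp add: sum.cartesian_product[symmetric] sum_distrib_left)
    also have "\<dots> = (\<Sum>u'<n. \<Sum>v'<n. 64 * (?g u u' * ?g v v'))"
      using p by (simp add: of_bool_def if_distrib[where f = "\<lambda>c. c * _"] cong: if_cong)
    also have "\<dots> = 64 * ((\<Sum>u'<n. ?g u u') * (\<Sum>v'<n. ?g v v'))"
      by (simp only: sum_product) (simp only: sum_distrib_left)
    also have "\<dots> \<le> 64 * ((2 * real n / (1 - lam)) * (2 * real n / (1 - lam)))"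
      using lam p by (intro mult_left_mono mult_mono sum_kernel_le sum_nonneg divide_nonneg_nonneg) auto
    also have "\<dots> = ?C * (real n)\<^sup>2" by (simp add: power2_eq_square)
    finally show ?thesis by simp
  qed
  have "(\<Sum>p\<in>?I. \<Sum>q\<in>?I. exp (measure ?M (chords (grid k n p) \<inter> chords (grid k n q))))
      \<le> (\<Sum>p\<in>?I. ?C * (real n)\<^sup>2 + (1 + 1 / k) * (k * (real n)\<^sup>2))"
    by (intro sum_mono row)
  also have "\<dots> = (1 + (?C + 1) / k) * (real (card ?I))\<^sup>2"
    using k by (simp add: field_simps power2_eq_square)
  finally show "(\<Sum>p\<in>?I. \<Sum>q\<in>?I. exp (measure ?M (chords (grid k n p) \<inter> chords (grid k n q))))
      \<le> (1 + (?C + 1) / k) * (real (card ?I))\<^sup>2" .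
qed

section \<open>Small intensity: vacant limit lines\<close>

lemma eventually_in_blockers:
  assumes "(a, b) \<in> blockers e t x y" "(e' \<longlongrightarrow> e) F" "(t' \<longlongrightarrow> t) F" "(x' \<longlongrightarrow> x) F" "(y' \<longlongrightarrow> y) F"
  shows "eventually (\<lambda>m. (a, b) \<in> blockers (e' m) (t' m) (x' m) (y' m)) F"
proof -
  let ?O = "{w. (a, b) \<in> blockers (fst w) (fst (snd w)) (fst (snd (snd w))) (snd (snd (snd w)))}"
  have "open ?O"
    unfolding blockers_def Un_iff mem_Collect_eq case_prod_conv
    by (intro open_Collect_disj open_Collect_conj open_Collect_less continuous_intros)
  moreover have "((\<lambda>m. (e' m, t' m, x' m, y' m)) \<longlongrightarrow> (e, t, x, y)) F"
    using assms by (intro tendsto_Pair)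
  ultimately have "eventually (\<lambda>m. (e' m, t' m, x' m, y' m) \<in> ?O) F"
    using assms(1) by (intro topological_tendstoD) auto
  then show ?thesis by simp
qed

text \<open>
  Compactness: the vacant grid lines for infinitely many \<open>n\<close> accumulate at some line.  Blocking is
  an open condition in the margin and the line jointly, so a line of \<open>S\<close> meeting the limit would
  block grid lines that were assumed to be vacant.  Here the third set of blockers excludes that
  the limit itself is in \<open>S\<close>.
\<close>

lemma vacant_line_of_grid_lines:
  assumes lines: "S \<subseteq> hyp_lines" "S \<inter> {L. None \<in> endpoints L} = {}"
    and vac: "\<And>m. \<exists>n\<ge>m. \<exists>p\<in>{..<k} \<times> {..<Suc n} \<times> {..<Suc n}. S \<inter> chords (grid k (Suc n) p) = {}"
  shows "\<exists>L\<in>hyp_lines. L \<subseteq> vacant_set S"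
proof -
  define R where "R = (3 * real k + 3)"
  have "\<exists>n i u v. n \<ge> m \<and> i < k \<and> u < Suc n \<and> v < Suc n \<and> S \<inter> chords (grid k (Suc n) (i, u, v)) = {}" for m
    using vac[of m] by auto
  then obtain f i u v where f: "f m \<ge> m" and iuv: "i m < k" "u m < Suc (f m)" "v m < Suc (f m)"
    and S: "S \<inter> chords (grid k (Suc (f m)) (i m, u m, v m)) = {}" for m :: nat
    by metis
  define e where "e m = 1 / real (Suc (f m))" for m
  define t where "t m = R * i m" for m
  define x where "x m = t m + real (u m) / real (Suc (f m))" for m
  define y where "y m = t m + 2 + real (v m) / real (Suc (f m))" for m
  have S': "S \<inter> chords (blockers (e m) (t m) (x m) (y m)) = {}" for m
    using S[of m] by (simp add: grid_def Let_def e_def t_def x_def y_def R_def)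
  have fr: "0 \<le> real w / real (Suc n) \<and> real w / real (Suc n) \<le> 1" if "w < Suc n" for w n
    using that by simp
  have xt: "t m \<le> x m" "x m \<le> t m + 1" and yt: "t m + 2 \<le> y m" "y m \<le> t m + 3" for m
    using fr[OF iuv(2)[of m]] fr[OF iuv(3)[of m]] by (simp_all add: x_def y_def)
  have t: "t m \<in> {0..R * k}" for m using iuv(1)[of m] by (simp add: t_def R_def)
  have "(t m, x m, y m) \<in> {0..R * k} \<times> {0..R * k + 1} \<times> {0..R * k + 3}" for m
    using t[of m] xt[of m] yt[of m] by auto
  moreover have "compact ({0..R * k} \<times> {0..R * k + 1} \<times> {0..R * k + 3})"
    by (intro compact_Times compact_Icc)
  ultimately obtain l r where r: "strict_mono r" and l: "((\<lambda>m. (t m, x m, y m)) \<circ> r) \<longlonglongrightarrow> l"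
    unfolding compact_def by meson
  obtain t0 x0 y0 where l0: "l = (t0, x0, y0)" using prod_cases3 by blast
  have tl: "(\<lambda>m. t (r m)) \<longlonglongrightarrow> t0" and xl: "(\<lambda>m. x (r m)) \<longlonglongrightarrow> x0" and yl: "(\<lambda>m. y (r m)) \<longlonglongrightarrow> y0"
    using tendsto_fst[OF l] tendsto_fst[OF tendsto_snd[OF l]] tendsto_snd[OF tendsto_snd[OF l]]
    by (simp_all add: l0 o_def)
  have el: "(\<lambda>m. e (r m)) \<longlonglongrightarrow> 0"
  proof (rule tendsto_sandwich[OF _ _ tendsto_const LIMSEQ_inverse_real_of_nat])
    show "eventually (\<lambda>m. 0 \<le> e (r m)) sequentially" by (simp add: e_def)
    have "e (r m) \<le> inverse (real (Suc m))" for m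
      using f[of "r m"] seq_suble[OF r, of m] by (simp add: e_def divide_simps)
    then show "eventually (\<lambda>m. e (r m) \<le> inverse (real (Suc m))) sequentially" by simp
  qed
  have lim: "t0 \<le> x0" "x0 \<le> t0 + 1" "t0 + 2 \<le> y0" "y0 \<le> t0 + 3"
    using xt yt by (auto intro!: LIMSEQ_le[OF tl xl] LIMSEQ_le[OF xl tendsto_add[OF tl tendsto_const]]
      LIMSEQ_le[OF tendsto_add[OF tl tendsto_const] yl] LIMSEQ_le[OF yl tendsto_add[OF tl tendsto_const]])
  then have xy: "x0 < y0" by linarith
  \<comment> \<open>A line of \<open>S\<close> meeting the limit is a blocker with margin zero.\<close>
  have "L \<inter> semicircle x0 y0 = {}" if L: "L \<in> S" for L
  proof (rule ccontr)
    assume meet: "L \<inter> semicircle x0 y0 \<noteq> {}"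
    have "L \<noteq> vertical a" for a using lines(2) L endpoints_vertical[of a] by auto
    then obtain a b where ab: "a < b" "L = semicircle a b"
      using hyp_lines_cases[of L] lines(1) L by blast
    then have "(a, b) \<in> blockers 0 t0 x0 y0"
      using semicircles_meet_imp[OF xy ab(1)] meet lim by (auto simp: blockers_def)
    from eventually_in_blockers[OF this el tl xl yl]
    obtain m where "(a, b) \<in> blockers (e (r m)) (t (r m)) (x (r m)) (y (r m))"
      unfolding eventually_sequentially by blast
    then have "L \<in> chords (blockers (e (r m)) (t (r m)) (x (r m)) (y (r m)))"
      using ab by (simp add: semicircle_in_chords_iff)
    then show False using S'[of "r m"] L by blast
  qed
  moreover have "semicircle x0 y0 \<subseteq> upper_half_plane"
    by (auto simp: semicircle_def upper_half_plane_def)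
  ultimately have "semicircle x0 y0 \<subseteq> vacant_set S" by (auto simp: vacant_set_def)
  then show ?thesis using semicircle_in_hyp_lines[OF xy] by blast
qed

text \<open>
  A lower bound for the probability of each event passes to the event that infinitely many of them
  occur.  The events that some line of a grid is vacant are of this kind: they are not monotone in
  the mesh, since the grids are not nested.
\<close>

lemma (in prob_space) prob_infinitely_often_ge:
  assumes B: "\<And>n::nat. B n \<in> events" and ge: "\<And>n. c \<le> prob (B n)"
  shows "c \<le> prob (\<Inter>m. \<Union>n\<in>{m..}. B n)"
proof -
  have "(\<lambda>m. prob (\<Union>n\<in>{m..}. B n)) \<longlonglongrightarrow> prob (\<Inter>m. \<Union>n\<in>{m..}. B n)"
  proof (rule finite_Lim_measure_decseq)
    show "decseq (\<lambda>m. \<Union>n\<in>{m..}. B n)" unfolding decseq_def by force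
  qed (use B in auto)
  moreover have "c \<le> prob (\<Union>n\<in>{m..}. B n)" for m
    using ge[of m] B by (intro order_trans[OF ge[of m] finite_measure_mono]) auto
  ultimately show ?thesis by (intro LIMSEQ_le_const) auto
qed

lemma AE_vacant_line:
  assumes pp: "poisson_process P (scale_measure (ennreal lam) \<Phi>) Y" and lam: "0 < lam" "lam < 1"
  shows "AE \<omega> in P. \<exists>L\<in>hyp_lines. L \<subseteq> vacant_set (Y \<omega>)"
proof -
  interpret prob_space P using pp by (simp add: poisson_process_def)
  let ?M = "scale_measure (ennreal lam) \<Phi>"
  define C where "C = (16 / (1 - lam))\<^sup>2 + 1"
  define B where "B k n = (\<Union>p\<in>{..<k} \<times> {..<Suc n} \<times> {..<Suc n}. void P Y (chords (grid k (Suc n) p)))" for k n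
  define G where "G k = (\<Inter>m. \<Union>n\<in>{m..}. B k n)" for k
  have "chords (grid k n p) \<in> sets ?M" for k n p
    by (cases p) (simp add: grid_def Let_def sets_chords open_blockers)
  then have B: "B k n \<in> events" for k n
    unfolding B_def by (intro sets.finite_UN sets_void[OF pp]) auto
  have G: "G k \<in> events" for k unfolding G_def using B by auto
  have G_ge: "1 - C / Suc k \<le> prob (G (Suc k))" for k
    unfolding G_def
  proof (intro prob_infinitely_often_ge B)
    show "1 - C / Suc k \<le> prob (B (Suc k) n)" for n
      unfolding B_def C_def by (intro prob_grid_vacant[OF pp lam]) auto
  qed
  have U: "(\<Union>k. G (Suc k)) \<in> events" using G by auto
  have "1 - C / Suc k \<le> prob (\<Union>k. G (Suc k))" for k
    using G U by (intro order_trans[OF G_ge[of k] finite_measure_mono]) auto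
  moreover have "(\<lambda>k. 1 - C / Suc k) \<longlonglongrightarrow> 1 - 0"
    by (intro tendsto_diff tendsto_const real_tendsto_divide_at_top[OF tendsto_const]
        filterlim_compose[OF filterlim_real_sequentially filterlim_Suc])
  ultimately have "1 - 0 \<le> prob (\<Union>k. G (Suc k))" by (intro LIMSEQ_le_const2) auto
  then have "prob (\<Union>k. G (Suc k)) = 1" using prob_le_1[of "\<Union>k. G (Suc k)"] by simp
  then have "AE \<omega> in P. \<omega> \<in> (\<Union>k. G (Suc k))" by (rule AE_prob_1)
  moreover have "AE \<omega> in P. \<omega> \<in> void P Y {L \<in> hyp_lines. None \<in> endpoints L}"
  proof (rule AE_prob_1)
    have N: "{L \<in> hyp_lines. None \<in> endpoints L} \<in> sets \<Phi>" "emeasure \<Phi> {L \<in> hyp_lines. None \<in> endpoints L} = ennreal 0"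
      using lines_to_infinity_null by (simp_all add: null_sets_def)
    have "{L \<in> hyp_lines. None \<in> endpoints L} \<in> fmeasurable ?M" "measure ?M {L \<in> hyp_lines. None \<in> endpoints L} = 0"
      using N lam by (auto intro!: fmeasurableI simp: measure_def)
    then show "prob (void P Y {L \<in> hyp_lines. None \<in> endpoints L}) = 1"
      using prob_void[OF pp] by simp
  qed
  moreover have "AE \<omega> in P. Y \<omega> \<subseteq> hyp_lines"
    using pp by (intro AE_I2) (auto simp: poisson_process_def space_scale_measure \<Phi>_def)
  ultimately show ?thesis
  proof eventually_elim
    case (elim \<omega>)
    then obtain k where k: "\<omega> \<in> G (Suc k)" by blast
    show ?case
    proof (rule vacant_line_of_grid_lines)
      show "Y \<omega> \<inter> {L. None \<in> endpoints L} = {}" using elim by (auto simp: void_def)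
      show "\<exists>n\<ge>m. \<exists>p\<in>{..<Suc k} \<times> {..<Suc n} \<times> {..<Suc n}. Y \<omega> \<inter> chords (grid (Suc k) (Suc n) p) = {}" for m
        using k unfolding G_def B_def void_def by fastforce
    qed (use elim in auto)
  qed
qed

section \<open>The phase transition\<close>

theorem proposition6p1:
  fixes P :: "'w measure" and Y :: "'w \<Rightarrow> complex set set" and lam :: real
  assumes "lam > 0"
    and "poisson_process P (scale_measure (ennreal lam) \<Phi>) Y"
  shows "(lam \<ge> 1 \<longrightarrow> (AE \<omega> in P. \<not> (\<exists>L \<in> hyp_lines. L \<subseteq> vacant_set (Y \<omega>)))) \<and>
         (lam < 1 \<longrightarrow> (AE \<omega> in P. \<exists>L \<in> hyp_lines. L \<subseteq> vacant_set (Y \<omega>)))"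
  using assms AE_no_vacant_line AE_vacant_line by blast

end
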